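(* Let $(\phi_t)$ be a non-elliptic semigroup in $\mathbb D$ with Denjoy-Wolff point $\tau$, Koenigs function $h$ and orthogonal speed $v^o(t)$. (1) Suppose that $h(\mathbb D)\subseteq p+\Xi(\alpha,\theta)$ for some $\alpha>1$, $\theta\in(0,\pi]$ and $p\in\mathbb C$. Then for any $\epsilon\in\left(0,\frac{\pi}{\theta+\pi}\right]$, $$\liminf_{t\to+\infty}\left[v^o(t)-\frac{\pi}{2\theta}(1-\epsilon)\log t\right]>-\infty,$$ or, equivalently, there exists $K(\epsilon)>0$ such that for all $t>0$, $$|\phi_t(0)-\tau|\le K(\epsilon)\,t^{(-1+\epsilon)\pi/\theta}.$$ (2) Suppose that $p+\Xi(\alpha,\theta)\subseteq h(\mathbb D)$ for some $\alpha>1$, $\theta\in(0,\pi]$ and $p\in\mathbb C$, and assume that $h(\mathbb D)$ is starlike with respect to an inner point. Then $$\limsup_{t\to+\infty}\left[v^o(t)-\frac{\pi}{2\theta}\log t\right]<+\infty,$$ or, equivalently, there exists $K>0$ such that for all $t\ge1$, $$|\phi_t(0)-\tau|\ge K\,t^{-\pi/\theta}.$$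
   Context: For $\alpha>1$ and $\theta\in(0,\pi]$ put $\Pi_\alpha:=\{z\in\mathbb C:\ \mathrm{Im}\,z>|\mathrm{Re}\,z|^\alpha\}$, $W(\theta):=\{z\in\mathbb C:\ \arg z\in(\frac\pi2-\theta,\frac\pi2)\}$, and $\Xi(\alpha,\theta):=(\{\mathrm{Re}\,z\le0\}\cap\Pi_\alpha)\cup W(\theta)$. A domain $\Omega$ is starlike with respect to an inner point if there is $w_0\in\Omega$ such that for every $w\in\Omega$ the segment joining $w_0$ and $w$ is contained in $\Omega$. Let $\mathbb D=\{z\in\mathbb C:|z|<1\}$. A (continuous) semigroup in $\mathbb D$ is a family $(\phi_t)_{t\ge0}$ of holomorphic self-maps of $\mathbb D$ with $\phi_0=\mathrm{id}$, $\phi_{s+t}=\phi_s\circ\phi_t$, and $t\mapsto\phi_t$ continuous for uniform convergence on compacta. It is non-elliptic if it has no fixed points in $\mathbb D$ (no $z\in\mathbb D$ with $\phi_t(z)=z$ for all $t\geq 0$). In that case there is a unique $\tau\in\partial\mathbb D$, the Denjoy-Wolff point, with $\lim_{t\to+\infty}\phi_t(z)=\tau$ for all $z\in\mathbb D$. A Koenigs function of a non-elliptic semigroup $(\phi_t)$ is a univalent function $h:\mathbb D\to\mathbb C$ such that (i) $h(\phi_t(z))=h(z)+it$ for all $z\in\mathbb D$, $t\ge0$, and (ii) $\bigcup_{t\ge0}(h(\mathbb D)-it)$ is a vertical strip, a vertical half-plane, or $\mathbb C$; it exists and is essentially unique (up to an additive constant). Let $k_{\mathbb D}$ be the hyperbolic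 distance of $\mathbb D$, normalized by $k_{\mathbb D}(0,z)=\frac12\log\frac{1+|z|}{1-|z|}$. For $z\in\mathbb D$ let $\pi(z)$ be the unique point of the geodesic $(-1,1)\tau$ that is closest to $z$ with respect to $k_{\mathbb D}$. The orthogonal speed of $(\phi_t)$ is $v^o(t):=k_{\mathbb D}(0,\pi(\phi_t(0)))$, $t\ge0$. *)

theory Defs
  imports "HOL-Complex_Analysis.Complex_Analysis"
begin

abbreviation unit_disc :: "complex set" where
  "unit_disc \<equiv> ball 0 1"

definition Pi_dom :: "real \<Rightarrow> complex set" where
  "Pi_dom \<alpha> = {z. Im z > \<bar>Re z\<bar> powr \<alpha>}"

(* The origin has no argument, whereas Arg 0 = 0; it must therefore be removed explicitly. *)
definition W_sector :: "real \<Rightarrow> complex set" where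
  "W_sector \<theta> = {z. z \<noteq> 0 \<and> Arg z \<in> {pi/2 - \<theta> <..< pi/2}}"

definition Xi_dom :: "real \<Rightarrow> real \<Rightarrow> complex set" where
  "Xi_dom \<alpha> \<theta> = ({z. Re z \<le> 0} \<inter> Pi_dom \<alpha>) \<union> W_sector \<theta>"

(* Families are indexed by all reals; only the values at t \<ge> 0 are constrained.
   The last clause is continuity of t \<mapsto> \<phi> t for uniform convergence on compacta. *)
definition disc_semigroup :: "(real \<Rightarrow> complex \<Rightarrow> complex) \<Rightarrow> bool" where
  "disc_semigroup \<phi> \<longleftrightarrow>
     (\<forall>t\<ge>0. \<phi> t holomorphic_on unit_disc \<and> \<phi> t ` unit_disc \<subseteq> unit_disc) \<and>
     (\<forall>z\<in>unit_disc. \<phi> 0 z = z) \<and>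
     (\<forall>s\<ge>0. \<forall>t\<ge>0. \<forall>z\<in>unit_disc. \<phi> (s + t) z = \<phi> s (\<phi> t z)) \<and>
     (\<forall>t\<ge>0. \<forall>K. compact K \<and> K \<subseteq> unit_disc \<longrightarrow>
        uniform_limit K \<phi> (\<phi> t) (at t within {0..}))"

definition non_elliptic :: "(real \<Rightarrow> complex \<Rightarrow> complex) \<Rightarrow> bool" where
  "non_elliptic \<phi> \<longleftrightarrow> \<not> (\<exists>z\<in>unit_disc. \<forall>t\<ge>0. \<phi> t z = z)"

definition denjoy_wolff_point :: "(real \<Rightarrow> complex \<Rightarrow> complex) \<Rightarrow> complex \<Rightarrow> bool" where
  "denjoy_wolff_point \<phi> \<tau> \<longleftrightarrow>
     \<tau> \<in> sphere 0 1 \<and> (\<forall>z\<in>unit_disc. ((\<lambda>t. \<phi> t z) \<longlongrightarrow> \<tau>) at_top)"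

definition vertical_strip :: "complex set \<Rightarrow> bool" where
  "vertical_strip S \<longleftrightarrow> (\<exists>a b. a < b \<and> S = {z. a < Re z \<and> Re z < b})"

definition vertical_half_plane :: "complex set \<Rightarrow> bool" where
  "vertical_half_plane S \<longleftrightarrow> (\<exists>a. S = {z. a < Re z} \<or> S = {z. Re z < a})"

definition koenigs_function ::
  "(real \<Rightarrow> complex \<Rightarrow> complex) \<Rightarrow> (complex \<Rightarrow> complex) \<Rightarrow> bool" where
  "koenigs_function \<phi> h \<longleftrightarrow>
     h holomorphic_on unit_disc \<and> inj_on h unit_disc \<and>
     (\<forall>z\<in>unit_disc. \<forall>t\<ge>0. h (\<phi> t z) = h z + \<i> * of_real t) \<and>
     (let S = (\<Union>t\<in>{0..}. (\<lambda>w. w - \<i> * of_real t) ` h ` unit_disc)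
      in vertical_strip S \<or> vertical_half_plane S \<or> S = UNIV)"

(* Hyperbolic distance of curvature -4: it is the pseudo-hyperbolic distance under
   r \<mapsto> (1/2) log ((1+r)/(1-r)), hence k(0,z) = (1/2) log ((1+|z|)/(1-|z|)).
   Meaningful for arguments in the disc only. *)
definition hyp_dist :: "complex \<Rightarrow> complex \<Rightarrow> real" where
  "hyp_dist z w =
     (let r = norm ((z - w) / (1 - cnj w * z)) in ln ((1 + r) / (1 - r)) / 2)"

definition diameter_geodesic :: "complex \<Rightarrow> complex set" where
  "diameter_geodesic \<tau> = {of_real r * \<tau> | r. -1 < r \<and> r < 1}"

definition orthogonal_projection :: "complex \<Rightarrow> complex \<Rightarrow> complex" where
  "orthogonal_projection \<tau> z =
     (THE w. w \<in> diameter_geodesic \<tau> \<and>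
             (\<forall>u\<in>diameter_geodesic \<tau>. hyp_dist z w \<le> hyp_dist z u))"

definition orthogonal_speed ::
  "(real \<Rightarrow> complex \<Rightarrow> complex) \<Rightarrow> complex \<Rightarrow> real \<Rightarrow> real" where
  "orthogonal_speed \<phi> \<tau> t = hyp_dist 0 (orthogonal_projection \<tau> (\<phi> t 0))"

end

theory Submission
  imports Defs
begin

text \<open>
  Let \<open>\<Omega>\<close> be the image of the Koenigs function \<open>h\<close>, and let \<open>f\<close> be \<open>h\<close> inverted and followed by the Cayley
  map that sends \<open>\<tau>\<close> to \<open>\<infinity>\<close>. Then \<open>f\<close> maps \<open>\<Omega>\<close> conformally onto the right half-plane, and the orbit of 0
  becomes \<open>w t = f (h 0 + \<i> t)\<close>, the image of a vertical half-line. The point of the positive axis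
  hyperbolically closest to \<open>w\<close> is \<open>\<bar>w\<bar>\<close>, so the orthogonal speed is \<open>ln \<bar>w t\<bar> / 2\<close> as soon as
  \<open>\<bar>w t\<bar> \<ge> 1\<close>. Also \<open>\<bar>\<phi> t 0 - \<tau>\<bar> = 2 / \<bar>w t + 1\<bar>\<close>. Everything thus reduces to the bounds
  \<open>\<bar>w t\<bar> \<ge> c t powr (\<pi> (1 - \<epsilon>) / \<theta>)\<close> for large \<open>t\<close> in the first part and \<open>\<bar>w t\<bar> \<le> C t powr (\<pi> / \<theta>)\<close> in the second.

  The difficulty is that \<open>w t\<close> may approach \<open>\<infinity>\<close> tangentially to the imaginary axis, where the
  Schwarz--Pick lemma gives no sharp information on \<open>\<bar>w t\<bar>\<close>. The Schwarz--Pick lemma does give sharp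
  growth bounds along hyperbolic geodesics, and the length--area principle \<open>length_area\<close>, in the form
  \<open>crossing_estimate\<close>, carries these over to the orbit: a univalent function with values in a half-plane cannot
  be large on a long path and small on a parallel one, up to a constant factor.

  In the first part \<open>\<Omega>\<close> lies in a sector of aperture \<open>\<theta> / (1 - \<epsilon>)\<close>, which a power map takes into the
  half-plane. Composed with the inverse of \<open>f\<close> this is a univalent self-map \<open>G\<close> of the half-plane
  with \<open>\<bar>G (w s)\<bar> \<ge> c s powr (\<pi> (1 - \<epsilon>) / \<theta>)\<close> on the orbit and \<open>\<bar>G x\<bar> \<le> x \<bar>G 1\<bar>\<close> on the axis. The comparison is
  along semicircles about 0, which the orbit crosses on its way to \<open>\<infinity>\<close>
  (\<open>trajectory_lower_bound\<close>).

  In the second part \<open>\<Omega>\<close> contains a translate of the sector \<open>W_sector \<theta>\<close>, and \<open>\<bar>f\<bar>\<close> is at most a multiple of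
  \<open>r powr (\<pi> / \<theta>)\<close> on its bisector. The comparison is along circular arcs that join the bisector to a
  vertical half-line in the sector. It requires that \<open>f\<close> is still large on that half-line at later times, and
  this is where starlikeness enters: it makes the hyperbolic distance to the centre increase along
  the half-line that starts there, while Wolff's lemma makes the real part of \<open>f\<close> increase; together they make \<open>\<bar>f\<bar>\<close>
  increasing up to a constant factor (\<open>starlike_trajectory_mono\<close>, \<open>trajectory_upper_bound\<close>).
\<close>

section \<open>The length--area principle\<close>

(* The dollar sign denotes vector components. *)
unbundle no fps_syntax

text \<open>The area of an image is computed by the change of variables theorem on \<open>real^2\<close>, the iterated integral by
  Fubini's theorem on \<open>real \<times> real\<close>; hence the coordinates.\<close>

definition complex_of_vec :: "real^2 \<Rightarrow> complex" where
  "complex_of_vec v = Complex (v $ 1) (v $ 2)"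

definition vec_of_complex :: "complex \<Rightarrow> real^2" where
  "vec_of_complex z = vector [Re z, Im z]"

lemma complex_of_vec_of_complex [simp]: "complex_of_vec (vec_of_complex z) = z"
  by (simp add: complex_of_vec_def vec_of_complex_def)

lemma vec_of_complex_of_vec [simp]: "vec_of_complex (complex_of_vec v) = v"
  by (simp add: complex_of_vec_def vec_of_complex_def vec_eq_iff forall_2)

lemma linear_complex_of_vec: "linear complex_of_vec"
  by (rule linearI) (simp_all add: complex_of_vec_def complex_eq_iff)

lemma linear_vec_of_complex: "linear vec_of_complex"
  by (rule linearI) (simp_all add: vec_of_complex_def vec_eq_iff forall_2)

lemma integral_real2_eq_integral_pair:
  fixes f :: "real \<times> real \<Rightarrow> real"
  assumes "f integrable_on cbox (a, c) (b, d)"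
  shows "((\<lambda>v. f (v $ 1, v $ 2)) has_integral integral (cbox (a, c) (b, d)) f)
           (cbox (vector [a, c]) (vector [b, d] :: real^2))"
proof -
  let ?g = "\<lambda>v::real^2. (v $ 1, v $ 2)" and ?h = "\<lambda>p::real \<times> real. vector [fst p, snd p] :: real^2"
  have hg: "?h (?g v) = v" and gh: "?g (?h p) = p" for v p
    by (simp_all add: vec_eq_iff forall_2)
  have img_g: "?g ` cbox u v = cbox (?g u) (?g v)" for u v
  proof (intro set_eqI iffI)
    fix p assume "p \<in> cbox (?g u) (?g v)"
    then have "?h p \<in> cbox u v"
      by (cases p) (simp add: mem_box_cart forall_2)
    then have "?g (?h p) \<in> ?g ` cbox u v"
      by (rule imageI)
    then show "p \<in> ?g ` cbox u v"
      unfolding gh .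
  qed (auto simp: mem_box_cart forall_2)
  have img_h: "?h ` cbox u v = cbox (?h u) (?h v)" for u v
  proof -
    have "cbox u v = ?g ` cbox (?h u) (?h v)"
      using img_g[of "?h u" "?h v"] gh by simp
    then have "?h ` cbox u v = (\<lambda>v. ?h (?g v)) ` cbox (?h u) (?h v)"
      by (simp add: image_image)
    then show ?thesis
      unfolding hg by simp
  qed
  have "((\<lambda>v. f (?g v)) has_integral (1 / 1) *\<^sub>R integral (cbox (a, c) (b, d)) f)
          (?h ` cbox (a, c) (b, d))"
  proof (rule has_integral_twiddle)
    show "continuous (at v) ?g" for v
      by (intro continuous_intros)
    show "\<exists>w z. ?g ` cbox u v = cbox w z" for u v
      using img_g by blast
    show "\<exists>w z. ?h ` cbox u v = cbox w z" for u v
      using img_h by blast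
    show "measure lborel (?g ` cbox u v) = 1 * measure lborel (cbox u v)" for u v
    proof (cases "cbox u v = {}")
      case False
      then have "u $ 1 \<le> v $ 1" "u $ 2 \<le> v $ 2"
        unfolding interval_ne_empty_cart by auto
      then show ?thesis
        unfolding img_g content_Pair content_cbox_cart[OF False] UNIV_2 by simp
    qed simp
    show "(f has_integral integral (cbox (a, c) (b, d)) f) (cbox (a, c) (b, d))"
      using assms by (rule integrable_integral)
  qed (use hg gh in auto)
  then show ?thesis
    by (simp add: img_h)
qed

text \<open>Multiplication by \<open>w\<close> is a rotation followed by the dilation by \<open>cmod w\<close>, so the Jacobian of a
  holomorphic map is the squared modulus of its derivative.\<close>

lemma det_complex_mult:
  "det (matrix (\<lambda>v. vec_of_complex (w * complex_of_vec v))) = (cmod w)\<^sup>2"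
proof -
  have "det (matrix (\<lambda>v. vec_of_complex (w * complex_of_vec v))) = (Re w)\<^sup>2 + (Im w)\<^sup>2"
    by (simp add: det_2 matrix_def vec_of_complex_def complex_of_vec_def axis_def power2_eq_square)
  then show ?thesis
    by (simp add: cmod_power2)
qed

text \<open>The double integral is the area of the image of the rectangle, as the map is injective; the image lies
  in the unit disc, hence in a square of side 2.\<close>

lemma area_univalent_le:
  assumes holg: "g holomorphic_on U" and U: "open U" and inj: "inj_on g U"
    and box: "cbox (Complex a c) (Complex b d) \<subseteq> U" and bound: "g ` U \<subseteq> ball 0 1"
  shows "integral (cbox a b) (\<lambda>x. integral (cbox c d) (\<lambda>y. (cmod (deriv g (Complex x y)))\<^sup>2)) \<le> 4"
proof -
  define f where "f = (\<lambda>p::real \<times> real. (cmod (deriv g (Complex (fst p) (snd p))))\<^sup>2)"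
  let ?Q = "cbox (vector [a, c]) (vector [b, d] :: real^2)"
  define G where "G = (\<lambda>v. vec_of_complex (g (complex_of_vec v)))"
  define G' where "G' = (\<lambda>x v. vec_of_complex (deriv g (complex_of_vec x) * complex_of_vec v))"
  have inU: "complex_of_vec v \<in> U" if "v \<in> ?Q" for v
    using that box by (intro subsetD[OF box]) (auto simp: complex_of_vec_def mem_box_cart forall_2 in_cbox_complex_iff)
  have contf: "continuous_on (cbox (a, c) (b, d)) f"
  proof -
    have *: "continuous_on U (deriv g)"
      using holg U by (intro holomorphic_on_imp_continuous_on holomorphic_deriv)
    have "continuous_on (cbox (a, c) (b, d)) (\<lambda>p. deriv g (Complex (fst p) (snd p)))"
    proof (rule continuous_on_compose2[OF *])
      show "continuous_on (cbox (a, c) (b, d)) (\<lambda>p. Complex (fst p) (snd p))"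
        unfolding Complex_eq by (intro continuous_intros)
      show "(\<lambda>p. Complex (fst p) (snd p)) ` cbox (a, c) (b, d) \<subseteq> U"
        using box by (auto simp: in_cbox_complex_iff)
    qed
    then show ?thesis
      unfolding f_def by (intro continuous_intros)
  qed
  have int: "((\<lambda>v. f (v $ 1, v $ 2)) has_integral integral (cbox (a, c) (b, d)) f) ?Q"
    by (rule integral_real2_eq_integral_pair[OF integrable_continuous[OF contf]])
  have det: "\<bar>det (matrix (G' v))\<bar> = f (v $ 1, v $ 2)" for v
    unfolding G'_def det_complex_mult by (simp add: f_def complex_of_vec_def)
  have der: "(G has_derivative G' v) (at v within ?Q)" if "v \<in> ?Q" for v
  proof -
    have "(g has_field_derivative deriv g (complex_of_vec v)) (at (complex_of_vec v))"
      using holg U inU[OF that] by (simp add: holomorphic_derivI)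
    then have dg: "(g has_derivative (*) (deriv g (complex_of_vec v))) (at (complex_of_vec v))"
      by (simp add: has_field_derivative_def)
    have d1: "(complex_of_vec has_derivative complex_of_vec) (at v within ?Q)"
      by (rule linear_imp_has_derivative[OF linear_complex_of_vec])
    have d2: "(vec_of_complex has_derivative vec_of_complex) (at (g (complex_of_vec v)))"
      by (rule linear_imp_has_derivative[OF linear_vec_of_complex])
    show ?thesis
      unfolding G_def G'_def
      using has_derivative_compose[OF has_derivative_compose[OF d1 dg] d2] by simp
  qed
  have injG: "inj_on G ?Q"
  proof (rule inj_onI)
    fix u v assume uv: "u \<in> ?Q" "v \<in> ?Q" "G u = G v"
    then have "g (complex_of_vec u) = g (complex_of_vec v)"
      unfolding G_def by (metis complex_of_vec_of_complex)
    then have "complex_of_vec u = complex_of_vec v"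
      using inj inU uv by (auto dest: inj_onD)
    then show "u = v"
      by (metis vec_of_complex_of_vec)
  qed
  have intdet: "(\<lambda>v. \<bar>det (matrix (G' v))\<bar>) integrable_on ?Q"
    unfolding det using int by blast
  have Q: "?Q \<in> sets lebesgue"
    by (simp add: lmeasurable_cbox fmeasurableD)
  have "measure lebesgue (G ` ?Q) = integral ?Q (\<lambda>v. \<bar>det (matrix (G' v))\<bar>)"
    by (rule measure_differentiable_image_eq[OF Q der injG intdet])
  also have "\<dots> = integral (cbox (a, c) (b, d)) f"
    unfolding det using int by (rule integral_unique)
  also have "\<dots> = integral (cbox a b) (\<lambda>x. integral (cbox c d) (\<lambda>y. f (x, y)))"
    by (rule integral_prod_continuous[OF contf])
  finally have eq: "measure lebesgue (G ` ?Q) = integral (cbox a b) (\<lambda>x. integral (cbox c d) (\<lambda>y. f (x, y)))" .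
  have "measure lebesgue (G ` ?Q) \<le> measure lebesgue (cbox (vector [-1, -1]) (vector [1, 1]) :: (real^2) set)"
  proof (rule measure_mono_fmeasurable)
    show "G ` ?Q \<subseteq> cbox (vector [-1, -1]) (vector [1, 1])"
    proof
      fix x assume "x \<in> G ` ?Q"
      then obtain v where v: "v \<in> ?Q" "x = G v" by blast
      then have "cmod (g (complex_of_vec v)) < 1"
        using inU[OF v(1)] bound by (auto simp: image_subset_iff)
      then have "\<bar>Re (g (complex_of_vec v))\<bar> \<le> 1" "\<bar>Im (g (complex_of_vec v))\<bar> \<le> 1"
        using abs_Re_le_cmod abs_Im_le_cmod by (meson less_imp_le order_trans)+
      then show "x \<in> cbox (vector [-1, -1]) (vector [1, 1])"
        unfolding v G_def by (auto simp: vec_of_complex_def mem_box_cart forall_2)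
    qed
    have "G differentiable_on ?Q"
      unfolding differentiable_on_def differentiable_def using der by blast
    show "G ` ?Q \<in> sets lebesgue"
      using iffD2[OF measurable_differentiable_image_eq[OF Q der injG] intdet] by (rule fmeasurableD)
  qed (rule lmeasurable_cbox)
  also have "\<dots> = 4"
  proof -
    have "cbox (vector [-1, -1]) (vector [1, 1] :: real^2) \<noteq> {}"
      by (simp add: interval_ne_empty_cart forall_2)
    then have "measure lborel (cbox (vector [-1, -1]) (vector [1, 1] :: real^2)) = 4"
      by (simp add: content_cbox_cart prod_2 UNIV_2)
    then show ?thesis
      by (simp add: measure_completion)
  qed
  finally show ?thesis
    using eq by (simp add: f_def)
qed

text \<open>The length of the image of each vertical segment is at least \<open>\<delta>\<close>. By the Cauchy--Schwarz inequality
  the integral of \<open>\<bar>g'\<bar>\<^sup>2\<close> over that segment is at least \<open>\<delta>\<^sup>2 / (d - c)\<close>, and the integral of this over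
  the horizontal side is at most the area of the image.\<close>

lemma length_area:
  assumes holg: "g holomorphic_on U" and U: "open U" and inj: "inj_on g U"
    and box: "cbox (Complex a c) (Complex b d) \<subseteq> U" and bound: "g ` U \<subseteq> ball 0 1"
    and "a \<le> b" "c < d" "0 < \<delta>"
    and osc: "\<And>x. x \<in> {a..b} \<Longrightarrow> \<exists>y\<in>{c..d}. \<exists>y'\<in>{c..d}. \<delta> \<le> cmod (g (Complex x y) - g (Complex x y'))"
  shows "(b - a) * \<delta>\<^sup>2 \<le> 4 * (d - c)"
proof -
  define F where "F = (\<lambda>x y. (cmod (deriv g (Complex x y)))\<^sup>2)"
  have cont: "continuous_on (cbox a b \<times> cbox c d) (\<lambda>p. cmod (deriv g (Complex (fst p) (snd p))))"
  proof -
    have *: "continuous_on U (deriv g)"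
      using holg U by (intro holomorphic_on_imp_continuous_on holomorphic_deriv)
    have "continuous_on (cbox a b \<times> cbox c d) (\<lambda>p. deriv g (Complex (fst p) (snd p)))"
    proof (rule continuous_on_compose2[OF *])
      show "continuous_on (cbox a b \<times> cbox c d) (\<lambda>p. Complex (fst p) (snd p))"
        unfolding Complex_eq by (intro continuous_intros)
      show "(\<lambda>p. Complex (fst p) (snd p)) ` (cbox a b \<times> cbox c d) \<subseteq> U"
        using box by (auto simp: in_cbox_complex_iff)
    qed
    then show ?thesis
      by (intro continuous_intros)
  qed
  have cont_y: "continuous_on {c..d} (\<lambda>y. cmod (deriv g (Complex x y)))" if "x \<in> {a..b}" for x
  proof -
    have "continuous_on {c..d} (\<lambda>y. cmod (deriv g (Complex (fst (x, y)) (snd (x, y)))))"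
      using that by (intro continuous_on_compose2[OF cont]) (auto intro!: continuous_intros)
    then show ?thesis by simp
  qed
  have F_int: "F x integrable_on {c..d}" if "x \<in> {a..b}" for x
    unfolding F_def by (intro integrable_continuous_real continuous_intros cont_y that)
  have lower: "\<delta>\<^sup>2 / (d - c) \<le> integral {c..d} (F x)" if x: "x \<in> {a..b}" for x
  proof -
    define N where "N = (\<lambda>y. cmod (deriv g (Complex x y)))"
    have N_int: "N integrable_on {c..d}"
      unfolding N_def by (intro integrable_continuous_real cont_y x)
    have diff: "cmod (g (Complex x v) - g (Complex x u)) \<le> integral {c..d} N"
      if "u \<in> {c..d}" "v \<in> {c..d}" "u \<le> v" for u v
    proof -
      have hv: "((\<lambda>y. g (Complex x y)) has_vector_derivative \<i> * deriv g (Complex x y)) (at y within {u..v})"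
        if "y \<in> {u..v}" for y
      proof -
        have "Complex x y \<in> U"
          using x that \<open>u \<in> _\<close> \<open>v \<in> _\<close> by (intro subsetD[OF box]) (auto simp: in_cbox_complex_iff)
        then have d: "(g has_field_derivative deriv g (Complex x y)) (at (Complex x y))"
          using holg U by (simp add: holomorphic_derivI)
        have "((\<lambda>y. Complex x y) has_vector_derivative \<i>) (at y within {u..v})"
          unfolding Complex_eq by (auto intro!: derivative_eq_intros)
        from field_vector_diff_chain_within[OF this has_field_derivative_at_within[OF d]]
        show ?thesis by (simp add: o_def)
      qed
      have 1: "((\<lambda>y. \<i> * deriv g (Complex x y)) has_integral (g (Complex x v) - g (Complex x u))) {u..v}"
        by (rule fundamental_theorem_of_calculus[OF \<open>u \<le> v\<close> hv])
      have sub: "{u..v} \<subseteq> {c..d}"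
        using that by auto
      have 2: "N integrable_on {u..v}"
        by (rule integrable_on_subinterval[OF N_int sub])
      have "cmod (g (Complex x v) - g (Complex x u)) \<le> integral {u..v} N"
        unfolding integral_unique[OF 1, symmetric]
        by (rule integral_norm_bound_integral) (use 1 2 in \<open>auto simp: N_def norm_mult integrable_on_def\<close>)
      also have "\<dots> \<le> integral {c..d} N"
        by (rule integral_subset_le[OF sub 2 N_int]) (simp add: N_def)
      finally show ?thesis .
    qed
    obtain y y' where y: "y \<in> {c..d}" "y' \<in> {c..d}" "\<delta> \<le> cmod (g (Complex x y) - g (Complex x y'))"
      using osc[OF x] by blast
    have "\<delta> \<le> integral {c..d} N"
      using y diff[of y y'] diff[of y' y] by (cases "y \<le> y'") (auto simp: norm_minus_commute)
    \<comment> \<open>The Cauchy--Schwarz inequality in the form of the pointwise bound \<open>2 \<kappa> N \<le> \<kappa>\<^sup>2 + N\<^sup>2\<close>.\<close>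
    define \<kappa> where "\<kappa> = \<delta> / (d - c)"
    have "\<kappa> > 0"
      using \<open>c < d\<close> \<open>0 < \<delta>\<close> by (simp add: \<kappa>_def)
    have "2 * \<kappa> * integral {c..d} N = integral {c..d} (\<lambda>y. 2 * \<kappa> * N y)"
      by simp
    also have "\<dots> \<le> integral {c..d} (\<lambda>y. \<kappa>\<^sup>2 + F x y)"
    proof (rule integral_le)
      show "2 * \<kappa> * N y \<le> \<kappa>\<^sup>2 + F x y" for y
        using sum_squares_bound[of \<kappa> "N y"] by (simp add: F_def N_def)
      show "(\<lambda>y. 2 * \<kappa> * N y) integrable_on {c..d}"
        by (rule integrable_on_mult_right[OF N_int])
      show "(\<lambda>y. \<kappa>\<^sup>2 + F x y) integrable_on {c..d}"
        by (intro integrable_add integrable_const_ivl F_int x)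
    qed
    also have "\<dots> = \<kappa>\<^sup>2 * (d - c) + integral {c..d} (F x)"
      using \<open>c < d\<close> by (subst integral_add) (auto intro: F_int x)
    finally have "2 * \<kappa> * integral {c..d} N \<le> \<kappa>\<^sup>2 * (d - c) + integral {c..d} (F x)" .
    moreover have "2 * \<kappa> * \<delta> \<le> 2 * \<kappa> * integral {c..d} N"
      using \<open>\<delta> \<le> integral {c..d} N\<close> \<open>\<kappa> > 0\<close> by simp
    moreover have "\<kappa> * \<delta> = \<delta>\<^sup>2 / (d - c)" "\<kappa>\<^sup>2 * (d - c) = \<delta>\<^sup>2 / (d - c)"
      using \<open>c < d\<close> by (simp_all add: \<kappa>_def power2_eq_square)
    ultimately show ?thesis by simp
  qed
  have "(b - a) * (\<delta>\<^sup>2 / (d - c)) = integral {a..b} (\<lambda>x. \<delta>\<^sup>2 / (d - c))"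
    using \<open>a \<le> b\<close> by simp
  also have "\<dots> \<le> integral {a..b} (\<lambda>x. integral {c..d} (F x))"
  proof (rule integral_le)
    have "continuous_on {a..b} (\<lambda>x. integral (cbox c d) (F x))"
    proof (rule integral_continuous_on_param)
      show "continuous_on ({a..b} \<times> cbox c d) (\<lambda>(x, y). F x y)"
        using cont by (auto simp: F_def case_prod_unfold intro!: continuous_intros)
    qed
    then show "(\<lambda>x. integral {c..d} (F x)) integrable_on {a..b}"
      by (simp add: integrable_continuous_real)
  qed (use lower in auto)
  also have "\<dots> \<le> 4"
    using area_univalent_le[OF holg U inj box bound] by (simp add: F_def)
  finally show ?thesis
    using \<open>c < d\<close> by (simp add: field_simps)
qed

section \<open>The Schwarz--Pick lemma in the right half-plane\<close>

abbreviation right_half_plane :: "complex set" where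
  "right_half_plane \<equiv> {w. Re w > 0}"

text \<open>In terms of the pseudo-hyperbolic distance \<open>q = cmod (a - b) / cmod (a + cnj b)\<close> of the right half-plane
  this reads \<open>1 - q\<^sup>2 = 4 Re a Re b / (cmod (a + cnj b))\<^sup>2\<close>.\<close>

lemma cmod_add_cnj_power2: "(cmod (a + cnj b))\<^sup>2 = (cmod (a - b))\<^sup>2 + 4 * Re a * Re b"
  unfolding cmod_power2 by (simp add: power2_eq_square algebra_simps)

text \<open>The Schwarz lemma, with \<open>b\<close> and \<open>G b\<close> moved to the origin: \<open>\<mu>\<close> maps the unit disc onto the half-plane
  and \<open>0\<close> to \<open>b\<close>.\<close>

lemma Schwarz_Pick_pseudo_distance:
  assumes "G holomorphic_on right_half_plane" "G ` right_half_plane \<subseteq> right_half_plane"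
    and "Re a > 0" "Re b > 0"
  shows "cmod (G a - G b) * cmod (a + cnj b) \<le> cmod (a - b) * cmod (G a + cnj (G b))"
proof -
  have Gpos: "Re (G w) > 0" if "Re w > 0" for w
    using assms(2) that by auto
  define \<mu> where "\<mu> = (\<lambda>z. (b + cnj b * z) / (1 - z))"
  define F where "F = (\<lambda>z. (G (\<mu> z) - G b) / (G (\<mu> z) + cnj (G b)))"
  have ne1: "1 - z \<noteq> 0" if "cmod z < 1" for z
    using that by auto
  have \<mu>_pos: "Re (\<mu> z) > 0" if z: "cmod z < 1" for z
  proof -
    have "Re (\<mu> z) = Re ((b + cnj b * z) * cnj (1 - z)) / (cmod (1 - z))\<^sup>2"
      unfolding \<mu>_def by (simp add: complex_div_cnj[of _ "1 - z"] flip: of_real_power)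
    also have "Re ((b + cnj b * z) * cnj (1 - z)) = Re b * (1 - (cmod z)\<^sup>2)"
      unfolding cmod_power2 by (simp add: power2_eq_square algebra_simps)
    finally show ?thesis
      using z \<open>Re b > 0\<close> ne1[OF z] by (simp add: power_less_one_iff abs_square_less_1)
  qed
  have den: "w + cnj v \<noteq> 0" if "Re w > 0" "Re v > 0" for w v
    using that by (auto simp: complex_eq_iff)
  have lt1: "cmod ((w - v) / (w + cnj v)) < 1" if "Re w > 0" "Re v > 0" for w v
  proof -
    have "(cmod (w - v))\<^sup>2 < (cmod (w + cnj v))\<^sup>2"
      unfolding cmod_add_cnj_power2 using that by simp
    then show ?thesis
      using den[OF that] by (simp add: norm_divide power_less_imp_less_base)
  qed
  have "cmod (F z) \<le> cmod z" if "cmod z < 1" for z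
  proof (rule Schwarz_Lemma)
    have "\<mu> holomorphic_on ball 0 1"
      unfolding \<mu>_def using ne1 by (intro holomorphic_intros) auto
    moreover have "\<mu> ` ball 0 1 \<subseteq> right_half_plane"
      using \<mu>_pos by auto
    ultimately have "(G \<circ> \<mu>) holomorphic_on ball 0 1"
      using assms(1) holomorphic_on_compose_gen by blast
    then show "F holomorphic_on ball 0 1"
      unfolding F_def o_def using den \<mu>_pos Gpos \<open>Re b > 0\<close> by (intro holomorphic_intros) auto
    show "F 0 = 0"
      by (simp add: F_def \<mu>_def)
    show "cmod (F z) < 1" if "cmod z < 1" for z
      unfolding F_def using \<mu>_pos[OF that] Gpos \<open>Re b > 0\<close> by (intro lt1) auto
  qed (use that in auto)
  then have *: "cmod (F ((a - b) / (a + cnj b))) \<le> cmod ((a - b) / (a + cnj b))"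
    using lt1[OF assms(3,4)] by blast
  have "\<mu> ((a - b) / (a + cnj b)) = a"
  proof -
    have "b + cnj b \<noteq> 0"
      using \<open>Re b > 0\<close> by (simp add: complex_eq_iff)
    moreover have "1 - (a - b) / (a + cnj b) = (b + cnj b) / (a + cnj b)"
      using den[OF assms(3,4)] by (simp add: field_simps)
    moreover have "b + cnj b * ((a - b) / (a + cnj b)) = a * (b + cnj b) / (a + cnj b)"
      using den[OF assms(3,4)] by (simp add: field_simps)
    ultimately show ?thesis
      using den[OF assms(3,4)] by (simp add: \<mu>_def)
  qed
  then show ?thesis
    using * den[OF assms(3,4)] den[OF Gpos Gpos, OF assms(3,4)]
    by (simp add: F_def norm_divide field_simps)
qed

text \<open>The same inequality in terms of \<open>1 - q\<^sup>2\<close>; it is this form that compares real parts.\<close>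

lemma Schwarz_Pick_conformal_factor:
  assumes "G holomorphic_on right_half_plane" "G ` right_half_plane \<subseteq> right_half_plane"
    and "Re a > 0" "Re b > 0"
  shows "Re a * Re b * (cmod (G a + cnj (G b)))\<^sup>2 \<le> Re (G a) * Re (G b) * (cmod (a + cnj b))\<^sup>2"
proof -
  have "(cmod (G a - G b) * cmod (a + cnj b))\<^sup>2 \<le> (cmod (a - b) * cmod (G a + cnj (G b)))\<^sup>2"
    using Schwarz_Pick_pseudo_distance[OF assms] by (rule power_mono) auto
  then have "(cmod (G a - G b))\<^sup>2 * (cmod (a + cnj b))\<^sup>2
      \<le> (cmod (a - b))\<^sup>2 * (cmod (G a + cnj (G b)))\<^sup>2"
    by (simp add: power_mult_distrib)
  then show ?thesis
    unfolding cmod_add_cnj_power2 by (simp add: algebra_simps)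
qed

text \<open>Points at bounded hyperbolic distance have comparable moduli: the quotient is at most
  \<open>(1 + q) / (1 - q)\<close>.\<close>

lemma cmod_le_of_Schwarz_Pick:
  assumes "G holomorphic_on right_half_plane" "G ` right_half_plane \<subseteq> right_half_plane"
    and "Re a > 0" "Re b > 0"
  shows "cmod (G a) * (cmod (a + cnj b) - cmod (a - b)) \<le> cmod (G b) * (cmod (a + cnj b) + cmod (a - b))"
proof -
  have "(cmod (G a) - cmod (G b)) * cmod (a + cnj b) \<le> cmod (G a - G b) * cmod (a + cnj b)"
    by (intro mult_right_mono norm_triangle_ineq2) auto
  also have "\<dots> \<le> cmod (a - b) * cmod (G a + cnj (G b))"
    by (rule Schwarz_Pick_pseudo_distance[OF assms])
  also have "\<dots> \<le> cmod (a - b) * (cmod (G a) + cmod (G b))"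
    using norm_triangle_ineq[of "G a" "cnj (G b)"] by (intro mult_left_mono) auto
  finally show ?thesis
    by (simp add: algebra_simps)
qed

text \<open>On the real axis \<open>(1 + q) / (1 - q)\<close> for the points \<open>x\<close> and \<open>1\<close> equals \<open>x\<close>. This linear bound is what
  the geodesic, in contrast to a tangential curve, offers.\<close>

lemma self_map_growth_on_real_axis:
  assumes "G holomorphic_on right_half_plane" "G ` right_half_plane \<subseteq> right_half_plane"
    and "x \<ge> 1"
  shows "cmod (G (of_real x)) \<le> x * cmod (G 1)"
proof -
  have "cmod (of_real x + 1 :: complex) = x + 1" "cmod (of_real x - 1 :: complex) = x - 1"
    using \<open>x \<ge> 1\<close> norm_of_real[of "x + 1", where 'a=complex] norm_of_real[of "x - 1", where 'a=complex] by simp_all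
  then show ?thesis
    using cmod_le_of_Schwarz_Pick[OF assms(1,2), of "of_real x" 1] \<open>x \<ge> 1\<close>
    by (simp add: mult.commute)
qed

lemma self_map_comparable:
  assumes "Re a > 0" "Re b > 0"
  obtains K where "K > 0" "\<And>G. G holomorphic_on right_half_plane \<Longrightarrow> G ` right_half_plane \<subseteq> right_half_plane
      \<Longrightarrow> cmod (G a) \<le> K * cmod (G b)"
proof
  have "(cmod (a - b))\<^sup>2 < (cmod (a + cnj b))\<^sup>2"
    unfolding cmod_add_cnj_power2 using assms by simp
  then have less: "cmod (a - b) < cmod (a + cnj b)"
    by (simp add: power_less_imp_less_base)
  let ?K = "(cmod (a + cnj b) + cmod (a - b)) / (cmod (a + cnj b) - cmod (a - b))"
  show "?K > 0"
    using less norm_ge_zero[of "a - b"] by (intro divide_pos_pos) linarith+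
  show "cmod (G a) \<le> ?K * cmod (G b)"
    if "G holomorphic_on right_half_plane" "G ` right_half_plane \<subseteq> right_half_plane" for G
    using cmod_le_of_Schwarz_Pick[OF that assms] less by (simp add: field_simps)
qed

text \<open>Wolff's lemma for the boundary fixed point \<open>\<infinity>\<close>, whose horodiscs are the half-planes \<open>Re w > c\<close>. In the
  Schwarz--Pick inequality for \<open>w\<close> and \<open>v n\<close> all factors cancel in the limit except the quotient of the
  numbers \<open>a n = Re (1 / v n)\<close>. These are positive and tend to 0, so \<open>a (Suc n) \<le> a n\<close> infinitely often.\<close>

lemma Re_mono_of_iterates_to_infinity:
  assumes hol: "G holomorphic_on right_half_plane" and self: "G ` right_half_plane \<subseteq> right_half_plane"
    and "Re w > 0" and pos: "\<And>n. Re (v n) > 0" and orbit: "\<And>n. v (Suc n) = G (v n)"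
    and lim: "filterlim v at_infinity sequentially"
  shows "Re w \<le> Re (G w)"
proof -
  define a where "a n = Re (v n) / (cmod (v n))\<^sup>2" for n
  define q where "q z n = (cmod (z / v n + cnj (v n) / v n))\<^sup>2" for z n
  have v0: "v n \<noteq> 0" for n
    using pos[of n] by auto
  have apos: "a n > 0" for n
    using pos[of n] v0[of n] by (simp add: a_def)
  have inv: "(\<lambda>n. inverse (v n)) \<longlonglongrightarrow> 0"
    by (rule filterlim_compose[OF tendsto_inverse_0 lim])
  have a_lim: "a \<longlonglongrightarrow> 0"
  proof -
    have "a n = Re (inverse (v n))" for n
      by (simp add: a_def Re_divide_numeral cmod_power2 inverse_complex.sel)
    then have "a = (\<lambda>n. Re (inverse (v n)))" by blast
    then show ?thesis
      using tendsto_Re[OF inv] by simp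
  qed
  have qlim: "q z \<longlonglongrightarrow> 1" for z
  proof -
    have z: "(\<lambda>n. cmod (z / v n)) \<longlonglongrightarrow> 0"
      using tendsto_norm[OF tendsto_mult_right_zero[OF inv, of z]] by (simp add: field_simps)
    have "(\<lambda>n. cmod (z / v n + cnj (v n) / v n)) \<longlonglongrightarrow> 1"
    proof (rule real_tendsto_sandwich)
      have u: "cmod (cnj (v n) / v n) = 1" for n
        using v0[of n] by (simp add: norm_divide)
      have "1 - cmod (z / v n) \<le> cmod (z / v n + cnj (v n) / v n)" for n
        using norm_diff_ineq[of "cnj (v n) / v n" "z / v n"] unfolding u by (simp add: add.commute)
      then show "eventually (\<lambda>n. 1 - cmod (z / v n) \<le> cmod (z / v n + cnj (v n) / v n)) sequentially"
        by (rule always_eventually[OF allI])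
      have "cmod (z / v n + cnj (v n) / v n) \<le> 1 + cmod (z / v n)" for n
        using norm_triangle_ineq[of "z / v n" "cnj (v n) / v n"] unfolding u by (simp add: add.commute)
      then show "eventually (\<lambda>n. cmod (z / v n + cnj (v n) / v n) \<le> 1 + cmod (z / v n)) sequentially"
        by (rule always_eventually[OF allI])
      show "(\<lambda>n. 1 - cmod (z / v n)) \<longlonglongrightarrow> 1" "(\<lambda>n. 1 + cmod (z / v n)) \<longlonglongrightarrow> 1"
        using tendsto_diff[OF tendsto_const[of 1] z] tendsto_add[OF tendsto_const[of 1] z] by simp_all
    qed
    from tendsto_power[OF this, of 2] show ?thesis
      by (simp add: q_def[abs_def])
  qed
  have qv: "(cmod (z + cnj (v n)))\<^sup>2 = q z n * (cmod (v n))\<^sup>2" for z n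
  proof -
    have "z / v n + cnj (v n) / v n = (z + cnj (v n)) / v n"
      by (simp add: add_divide_distrib)
    then show ?thesis
      using v0[of n] by (simp add: q_def norm_divide power_divide)
  qed
  have step: "Re w * a n * q (G w) (Suc n) \<le> Re (G w) * a (Suc n) * q w n" for n
  proof -
    have "Re w * Re (v n) * (q (G w) (Suc n) * (cmod (v (Suc n)))\<^sup>2)
        \<le> Re (G w) * Re (v (Suc n)) * (q w n * (cmod (v n))\<^sup>2)"
      using Schwarz_Pick_conformal_factor[OF hol self \<open>Re w > 0\<close> pos[of n]]
      unfolding orbit[symmetric] qv .
    then show ?thesis
      using v0[of n] v0[of "Suc n"] by (simp add: a_def field_simps)
  qed
  have freq: "\<exists>n\<ge>N. a (Suc n) \<le> a n" for N
  proof (rule ccontr)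
    assume "\<not> ?thesis"
    then have inc: "a n \<le> a (Suc n)" if "n \<ge> N" for n
      using that by force
    have "a N \<le> a n" if "n \<ge> N" for n
      using that by (induction n rule: dec_induct) (auto intro: order_trans inc)
    then have "a N \<le> 0"
      using a_lim by (intro tendsto_lowerbound[OF a_lim]) (auto simp: eventually_sequentially)
    then show False
      using apos[of N] by simp
  qed
  have GR: "Re (G w) > 0"
    using self \<open>Re w > 0\<close> by auto
  show ?thesis
  proof (rule ccontr)
    assume "\<not> ?thesis"
    then have less: "Re (G w) < Re w" by simp
    have "(\<lambda>n. Re w * q (G w) (Suc n)) \<longlonglongrightarrow> Re w * 1" "(\<lambda>n. Re (G w) * q w n) \<longlonglongrightarrow> Re (G w) * 1"
      by (intro tendsto_intros qlim LIMSEQ_Suc)+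
    then have "(\<lambda>n. Re w * q (G w) (Suc n) - Re (G w) * q w n) \<longlonglongrightarrow> Re w * 1 - Re (G w) * 1"
      by (rule tendsto_diff)
    then have "eventually (\<lambda>n. Re w * q (G w) (Suc n) - Re (G w) * q w n > 0) sequentially"
      using less by (intro order_tendstoD) auto
    then obtain N where N: "\<And>n. n \<ge> N \<Longrightarrow> Re (G w) * q w n < Re w * q (G w) (Suc n)"
      by (auto simp: eventually_sequentially)
    obtain n where n: "n \<ge> N" "a (Suc n) \<le> a n"
      using freq by blast
    have "Re (G w) * a (Suc n) * q w n \<le> a n * (Re (G w) * q w n)"
      using mult_right_mono[OF n(2), of "Re (G w) * q w n"] GR
      by (simp add: q_def mult.commute mult.left_commute)
    also have "\<dots> < a n * (Re w * q (G w) (Suc n))"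
      using N[OF n(1)] apos[of n] by simp
    finally show False
      using step[of n] by (simp add: mult.commute mult.left_commute)
  qed
qed

section \<open>Long paths in a strip\<close>

text \<open>The form of the length--area principle that both parts of the proposition use. If \<open>\<bar>g\<bar>\<close> is large on a path
  running along a strip and small on a horizontal segment, then every vertical
  cross-cut meets both, and \<open>g\<close> has to oscillate on it. Composing with the Moebius map \<open>w \<mapsto> w / (w + m)\<close> of
  the right half-plane into the unit disc turns this into an oscillation of size \<open>1/4\<close> of a bounded
  univalent function, so the path cannot be long. The bound is uniform in how close the path comes to
  the edges of the strip, so it covers orbits that approach the boundary tangentially.\<close>

lemma crossing_estimate:
  fixes g :: "complex \<Rightarrow> complex" and \<xi> :: "real \<Rightarrow> complex" and c d :: real
  defines "S \<equiv> {z. c < Im z \<and> Im z < d}"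
  assumes holg: "g holomorphic_on S" and inj: "inj_on g S" and gS: "g ` S \<subseteq> right_half_plane"
    and cont: "continuous_on {s0..s1} \<xi>" and \<xi>S: "\<xi> ` {s0..s1} \<subseteq> S" and "s0 \<le> s1"
    and ends: "Re (\<xi> s0) \<le> a" "b \<le> Re (\<xi> s1)" and "a \<le> b"
    and "0 < m" and large: "\<And>s. s \<in> {s0..s1} \<Longrightarrow> m \<le> cmod (g (\<xi> s))"
    and y0: "c < y0" "y0 < d" and small: "\<And>x. x \<in> {a..b} \<Longrightarrow> 5 * cmod (g (Complex x y0)) \<le> m"
  shows "b - a \<le> 64 * (d - c)"
proof -
  define \<Phi> where "\<Phi> = (\<lambda>z. g z / (g z + of_real m))"
  have gpos: "Re (g z) > 0" if "z \<in> S" for z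
    using gS that by auto
  have den: "g z + of_real m \<noteq> 0" if "z \<in> S" for z
    using gpos[OF that] \<open>0 < m\<close> by (auto simp: complex_eq_iff)
  have hol\<Phi>: "\<Phi> holomorphic_on S"
    unfolding \<Phi>_def using den by (intro holomorphic_intros holg) auto
  have inj\<Phi>: "inj_on \<Phi> S"
  proof (rule inj_onI)
    fix z z' assume z: "z \<in> S" "z' \<in> S" and "\<Phi> z = \<Phi> z'"
    then have "g z * (g z' + of_real m) = g z' * (g z + of_real m)"
      using den by (simp add: \<Phi>_def frac_eq_eq)
    then have "g z = g z'"
      using \<open>0 < m\<close> by (simp add: algebra_simps)
    then show "z = z'"
      using inj z by (auto dest: inj_onD)
  qed
  have \<Phi>_ball: "\<Phi> ` S \<subseteq> ball 0 1"
  proof (rule image_subsetI)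
    fix z assume z: "z \<in> S"
    have "(cmod (g z))\<^sup>2 < (cmod (g z + of_real m))\<^sup>2"
      unfolding cmod_power2 using gpos[OF z] \<open>0 < m\<close> by (simp add: power2_eq_square algebra_simps add_pos_pos)
    then have "cmod (g z) < cmod (g z + of_real m)"
      by (simp add: power_less_imp_less_base)
    then show "\<Phi> z \<in> ball 0 1"
      using den[OF z] by (simp add: \<Phi>_def norm_divide)
  qed
  have opS: "open S"
    unfolding S_def by (intro open_Collect_conj open_Collect_less continuous_intros)
  have contI: "continuous_on {s0..s1} (\<lambda>s. Im (\<xi> s))" and contR: "continuous_on {s0..s1} (\<lambda>s. Re (\<xi> s))"
    by (intro continuous_intros cont)+
  have ne: "{s0..s1} \<noteq> {}"
    using \<open>s0 \<le> s1\<close> by simp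
  \<comment> \<open>The path is compact, so a closed subrectangle of the strip contains it together with the segment.\<close>
  obtain sl where sl: "sl \<in> {s0..s1}" "\<And>s. s \<in> {s0..s1} \<Longrightarrow> Im (\<xi> sl) \<le> Im (\<xi> s)"
    using continuous_attains_inf[OF compact_Icc ne contI] by blast
  obtain su where su: "su \<in> {s0..s1}" "\<And>s. s \<in> {s0..s1} \<Longrightarrow> Im (\<xi> s) \<le> Im (\<xi> su)"
    using continuous_attains_sup[OF compact_Icc ne contI] by blast
  have "sl \<in> {s0..s1} \<Longrightarrow> \<xi> sl \<in> S" "su \<in> {s0..s1} \<Longrightarrow> \<xi> su \<in> S"
    using \<xi>S by blast+
  then have "c < min (Im (\<xi> sl)) y0" "max (Im (\<xi> su)) y0 < d"
    using sl su y0 by (auto simp: S_def)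
  then obtain c' d' where c': "c < c'" "c' < min (Im (\<xi> sl)) y0" and d': "d' < d" "max (Im (\<xi> su)) y0 < d'"
    using dense by metis
  have "(b - a) * (1 / 4)\<^sup>2 \<le> 4 * (d' - c')"
  proof (rule length_area[OF hol\<Phi> opS inj\<Phi> _ \<Phi>_ball \<open>a \<le> b\<close>])
    show "cbox (Complex a c') (Complex b d') \<subseteq> S"
      using c' d' by (auto simp: in_cbox_complex_iff S_def)
    show "c' < d'"
      using c' d' by linarith
    fix x assume x: "x \<in> {a..b}"
    have "\<exists>s\<ge>s0. s \<le> s1 \<and> Re (\<xi> s) = x"
      by (rule IVT') (use ends x contR \<open>s0 \<le> s1\<close> in auto)
    then obtain s where s: "s \<in> {s0..s1}" "Re (\<xi> s) = x"
      by auto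
    then have xi: "\<xi> s = Complex x (Im (\<xi> s))"
      by (simp add: complex_eq_iff)
    have "\<xi> s \<in> S"
      using s \<xi>S by blast
    have "cmod (g (\<xi> s) + of_real m) \<le> 2 * cmod (g (\<xi> s))"
      using norm_triangle_ineq[of "g (\<xi> s)" "of_real m"] large[OF s(1)] \<open>0 < m\<close> by simp
    then have 1: "1 / 2 \<le> cmod (\<Phi> (\<xi> s))"
      using den[OF \<open>\<xi> s \<in> S\<close>] by (simp add: \<Phi>_def norm_divide field_simps)
    have "Complex x y0 \<in> S"
      using y0 by (simp add: S_def)
    have "4 * cmod (g (Complex x y0)) \<le> cmod (g (Complex x y0) + of_real m)"
      using norm_diff_ineq[of "of_real m" "g (Complex x y0)"] small[OF x] \<open>0 < m\<close> by (simp add: add.commute)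
    then have "cmod (\<Phi> (Complex x y0)) \<le> 1 / 4"
      using den[OF \<open>Complex x y0 \<in> S\<close>] by (simp add: \<Phi>_def norm_divide field_simps)
    with 1 have "1 / 4 \<le> cmod (\<Phi> (Complex x (Im (\<xi> s))) - \<Phi> (Complex x y0))"
      using norm_triangle_ineq2[of "\<Phi> (\<xi> s)" "\<Phi> (Complex x y0)"] xi by simp
    moreover have "Im (\<xi> s) \<in> {c'..d'}" "y0 \<in> {c'..d'}"
      using c' d' sl(2)[OF s(1)] su(2)[OF s(1)] by auto
    ultimately show "\<exists>y\<in>{c'..d'}. \<exists>y'\<in>{c'..d'}. 1 / 4 \<le> cmod (\<Phi> (Complex x y) - \<Phi> (Complex x y'))"
      by blast
  qed simp
  then show ?thesis
    using c' d' by (simp add: power2_eq_square)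
qed

section \<open>Orthogonal projection and orthogonal speed\<close>

text \<open>Maps the unit disc onto the right half-plane, \<open>\<tau>\<close> to \<open>\<infinity>\<close> and the geodesic \<open>(-1, 1) \<tau>\<close> onto the
  positive real axis.\<close>

definition cayley :: "complex \<Rightarrow> complex \<Rightarrow> complex" where
  "cayley \<tau> z = (\<tau> + z) / (\<tau> - z)"

lemma cayley_denominator:
  assumes "cmod \<tau> = 1" "cmod z < 1"
  shows "\<tau> - z \<noteq> 0"
  using assms by auto

lemma Re_cayley_pos:
  assumes "cmod \<tau> = 1" "cmod z < 1"
  shows "Re (cayley \<tau> z) > 0"
proof -
  have "Re (cayley \<tau> z) = Re ((\<tau> + z) * cnj (\<tau> - z)) / (cmod (\<tau> - z))\<^sup>2"
    unfolding cayley_def by (simp add: complex_div_cnj[of _ "\<tau> - z"] flip: of_real_power)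
  also have "Re ((\<tau> + z) * cnj (\<tau> - z)) = (cmod \<tau>)\<^sup>2 - (cmod z)\<^sup>2"
    unfolding cmod_power2 by (simp add: power2_eq_square algebra_simps)
  finally show ?thesis
    using assms cayley_denominator[OF assms] by (simp add: abs_square_less_1)
qed

lemma cayley_plus_1:
  assumes "cmod \<tau> = 1" "cmod z < 1"
  shows "cayley \<tau> z + 1 = 2 * \<tau> / (\<tau> - z)"
  using cayley_denominator[OF assms] by (simp add: cayley_def field_simps)

lemma dist_eq_cayley:
  assumes "cmod \<tau> = 1" "cmod z < 1"
  shows "cmod (z - \<tau>) = 2 / cmod (cayley \<tau> z + 1)"
  using cayley_denominator[OF assms] assms
  by (simp add: cayley_plus_1[OF assms] norm_divide norm_mult norm_minus_commute)

lemma inj_on_cayley: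
  assumes "cmod \<tau> = 1"
  shows "inj_on (cayley \<tau>) unit_disc"
proof (rule inj_onI)
  fix z z' assume "z \<in> unit_disc" "z' \<in> unit_disc" and eq: "cayley \<tau> z = cayley \<tau> z'"
  then have z: "cmod z < 1" "cmod z' < 1" by auto
  have "2 * \<tau> / (\<tau> - z) = 2 * \<tau> / (\<tau> - z')"
    using cayley_plus_1[OF assms z(1)] cayley_plus_1[OF assms z(2)] eq by metis
  moreover have "\<tau> \<noteq> 0"
    using assms by auto
  ultimately show "z = z'"
    using cayley_denominator[OF assms z(1)] cayley_denominator[OF assms z(2)] by (auto simp: frac_eq_eq)
qed

lemma abs_minus_1_div_plus_1_less_1: "\<bar>(y - 1) / (y + 1)\<bar> < 1" if "y > 0" for y :: real
proof -
  have "\<bar>y - 1\<bar> < y + 1"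
    using that by (simp add: abs_if)
  then show ?thesis
    using that by (simp add: abs_divide)
qed

text \<open>In the half-plane the point \<open>of_real r * \<tau>\<close> becomes \<open>x\<close>. The distance is written as an expression that is
  visibly increasing in the pseudo-hyperbolic distance.\<close>

lemma hyp_dist_diameter:
  assumes "cmod \<tau> = 1" "cmod z < 1" "\<bar>r\<bar> < 1" and x: "x = (1 + r) / (1 - r)"
  shows "hyp_dist z (of_real r * \<tau>)
    = ln (2 / (1 - cmod (cayley \<tau> z - of_real x) / cmod (cayley \<tau> z + of_real x)) - 1) / 2"
    and "cmod (cayley \<tau> z - of_real x) < cmod (cayley \<tau> z + of_real x)"
proof -
  define w where "w = cayley \<tau> z"
  have "x > 0"
    using assms by (simp add: x)
  have "Re w > 0"
    unfolding w_def by (rule Re_cayley_pos[OF assms(1,2)])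
  have "(cmod (w - of_real x))\<^sup>2 < (cmod (w + of_real x))\<^sup>2"
    using cmod_add_cnj_power2[of w "of_real x"] \<open>x > 0\<close> \<open>Re w > 0\<close> by simp
  then have lt: "cmod (w - of_real x) < cmod (w + of_real x)"
    by (simp add: power_less_imp_less_base)
  then show "cmod (cayley \<tau> z - of_real x) < cmod (cayley \<tau> z + of_real x)"
    by (simp add: w_def)
  have r1: "1 - complex_of_real r \<noteq> 0"
    using \<open>\<bar>r\<bar> < 1\<close> by (metis abs_one less_irrefl of_real_1 of_real_eq_iff right_minus_eq)
  have \<tau>z: "\<tau> - z \<noteq> 0"
    by (rule cayley_denominator[OF assms(1,2)])
  have X: "complex_of_real x = (1 + of_real r) / (1 - of_real r)"
    by (simp add: x)
  have \<tau>\<tau>: "cnj \<tau> * \<tau> = 1"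
    using complex_norm_square[of \<tau>] assms(1) by (simp add: mult.commute)
  have 1: "w - of_real x = 2 * (z - of_real r * \<tau>) / ((\<tau> - z) * (1 - of_real r))"
    unfolding w_def cayley_def X using r1 \<tau>z by (simp add: field_simps)
  have 2: "w + of_real x = 2 * (\<tau> - of_real r * z) / ((\<tau> - z) * (1 - of_real r))"
    unfolding w_def cayley_def X using r1 \<tau>z by (simp add: field_simps)
  have "\<tau> - of_real r * z = \<tau> * (1 - cnj (of_real r * \<tau>) * z)"
    using \<tau>\<tau> by (simp add: algebra_simps)
  then have "cmod (\<tau> - of_real r * z) = cmod (1 - cnj (of_real r * \<tau>) * z)"
    using assms(1) by (metis norm_mult mult_1)
  then have "cmod ((z - of_real r * \<tau>) / (1 - cnj (of_real r * \<tau>) * z)) = cmod (w - of_real x) / cmod (w + of_real x)"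
    unfolding 1 2 using r1 \<tau>z by (simp only: norm_divide norm_mult) simp
  moreover have "(1 + q) / (1 - q) = 2 / (1 - q) - 1" if "q < 1" for q :: real
    using that by (simp add: field_simps)
  ultimately show "hyp_dist z (of_real r * \<tau>)
    = ln (2 / (1 - cmod (cayley \<tau> z - of_real x) / cmod (cayley \<tau> z + of_real x)) - 1) / 2"
    using lt le_less_trans[OF norm_ge_zero lt] by (simp add: hyp_dist_def Let_def flip: w_def)
qed

text \<open>With \<open>w = cayley \<tau> z\<close> the pseudo-hyperbolic distance \<open>\<rho>\<close> of \<open>w\<close> and \<open>x > 0\<close> satisfies
  \<open>1 - \<rho>\<^sup>2 = 4 Re w / (\<bar>w\<bar>\<^sup>2 / x + x + 2 Re w)\<close>, which is largest exactly at \<open>x = \<bar>w\<bar>\<close>. The number \<open>r0\<close>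
  corresponds to \<open>x = \<bar>w\<bar>\<close>.\<close>

lemma hyp_dist_diameter_minimal:
  assumes \<tau>: "cmod \<tau> = 1" and z: "cmod z < 1" and r: "\<bar>r\<bar> < 1" 
    and r0: "r0 = (cmod (cayley \<tau> z) - 1) / (cmod (cayley \<tau> z) + 1)" and "r \<noteq> r0"
  shows "hyp_dist z (of_real r0 * \<tau>) < hyp_dist z (of_real r * \<tau>)"
proof -
  define w where "w = cayley \<tau> z"
  define x where "x = (1 + r) / (1 - r)"
  define \<rho> where "\<rho> = (\<lambda>x. cmod (w - of_real x) / cmod (w + of_real x))"
  have "Re w > 0"
    unfolding w_def by (rule Re_cayley_pos[OF \<tau> z])
  then have w0: "cmod w > 0"
    by auto
  have r0_lt: "\<bar>r0\<bar> < 1"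
    using abs_minus_1_div_plus_1_less_1[OF w0] unfolding r0 w_def[symmetric] .
  have x0: "cmod w = (1 + r0) / (1 - r0)"
  proof -
    have w0_1: "cmod w + 1 \<noteq> 0"
      using w0 by linarith
    have "1 + r0 = 2 * cmod w / (cmod w + 1)" "1 - r0 = 2 / (cmod w + 1)"
      using w0_1 unfolding r0 w_def[symmetric] by (simp_all add: field_simps)
    then show ?thesis
      using w0_1 by simp
  qed
  have "x > 0"
    using r by (simp add: x_def)
  have "x \<noteq> cmod w"
    using \<open>r \<noteq> r0\<close> r r0_lt unfolding x0 x_def by (auto simp: field_simps)
  have lt1: "\<rho> x < 1" "\<rho> (cmod w) < 1"
    using hyp_dist_diameter(2)[OF \<tau> z r x_def] hyp_dist_diameter(2)[OF \<tau> z r0_lt x0]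
    unfolding \<rho>_def w_def[symmetric] by (auto simp: divide_less_eq_1 intro: le_less_trans[OF norm_ge_zero])
  have sq: "(\<rho> y)\<^sup>2 = 1 - 4 * Re w / ((cmod w)\<^sup>2 / y + y + 2 * Re w)" if "y > 0" for y
  proof -
    have "(cmod (w + of_real y))\<^sup>2 = y * ((cmod w)\<^sup>2 / y + y + 2 * Re w)"
      unfolding cmod_power2 using that by (simp add: power2_eq_square field_simps)
    moreover have "(cmod (w - of_real y))\<^sup>2 = (cmod (w + of_real y))\<^sup>2 - 4 * Re w * y"
      using cmod_add_cnj_power2[of w "of_real y"] by simp
    moreover have "y * ((cmod w)\<^sup>2 / y + y + 2 * Re w) > 0"
      using that \<open>Re w > 0\<close> w0 by (intro mult_pos_pos add_pos_pos) auto
    moreover have "(cmod w)\<^sup>2 / y + y + 2 * Re w \<noteq> 0"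
      using calculation(3) by auto
    ultimately show ?thesis
      using that by (simp add: \<rho>_def power_divide diff_divide_distrib)
  qed
  have "(cmod w)\<^sup>2 / cmod w + cmod w < (cmod w)\<^sup>2 / x + x"
  proof -
    have "0 < (cmod w - x)\<^sup>2"
      using \<open>x \<noteq> cmod w\<close> by simp
    then show ?thesis
      using \<open>x > 0\<close> w0 by (simp add: power2_eq_square field_simps)
  qed
  then have "(\<rho> (cmod w))\<^sup>2 < (\<rho> x)\<^sup>2"
    unfolding sq[OF w0] sq[OF \<open>x > 0\<close>] using \<open>Re w > 0\<close> w0 \<open>x > 0\<close>
    by (simp add: divide_strict_left_mono add_pos_pos mult_pos_pos)
  then have \<rho>_less: "\<rho> (cmod w) < \<rho> x"
    by (rule power_less_imp_less_base) (simp add: \<rho>_def)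
  have "0 \<le> \<rho> (cmod w)"
    by (simp add: \<rho>_def)
  have "0 < 2 / (1 - \<rho> (cmod w)) - 1"
    using lt1 \<open>0 \<le> \<rho> (cmod w)\<close> by (simp add: field_simps)
  moreover have "2 / (1 - \<rho> (cmod w)) - 1 < 2 / (1 - \<rho> x) - 1"
    using lt1 \<rho>_less by (simp add: frac_less2)
  ultimately have "ln (2 / (1 - \<rho> (cmod w)) - 1) < ln (2 / (1 - \<rho> x) - 1)"
    by simp
  then show ?thesis
    unfolding hyp_dist_diameter(1)[OF \<tau> z r x_def] hyp_dist_diameter(1)[OF \<tau> z r0_lt x0] w_def[symmetric]
    by (simp add: \<rho>_def)
qed

lemma orthogonal_projection_eq:
  assumes \<tau>: "cmod \<tau> = 1" and z: "cmod z < 1"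
  shows "orthogonal_projection \<tau> z
    = of_real ((cmod (cayley \<tau> z) - 1) / (cmod (cayley \<tau> z) + 1)) * \<tau>"
proof -
  define r0 where "r0 = (cmod (cayley \<tau> z) - 1) / (cmod (cayley \<tau> z) + 1)"
  have "cmod (cayley \<tau> z) > 0"
    using Re_cayley_pos[OF \<tau> z] by auto
  from abs_minus_1_div_plus_1_less_1[OF this] have "-1 < r0" "r0 < 1"
    unfolding r0_def by linarith+
  note less = hyp_dist_diameter_minimal[OF \<tau> z _ r0_def]
  have "orthogonal_projection \<tau> z = of_real r0 * \<tau>"
    unfolding orthogonal_projection_def
  proof (rule the_equality)
    show "of_real r0 * \<tau> \<in> diameter_geodesic \<tau> \<and>
        (\<forall>u\<in>diameter_geodesic \<tau>. hyp_dist z (of_real r0 * \<tau>) \<le> hyp_dist z u)"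
    proof (intro conjI ballI)
      show "of_real r0 * \<tau> \<in> diameter_geodesic \<tau>"
        using \<open>-1 < r0\<close> \<open>r0 < 1\<close> by (auto simp: diameter_geodesic_def)
      fix u assume "u \<in> diameter_geodesic \<tau>"
      then obtain r where r: "u = of_real r * \<tau>" "-1 < r" "r < 1"
        by (auto simp: diameter_geodesic_def)
      then show "hyp_dist z (of_real r0 * \<tau>) \<le> hyp_dist z u"
        using less[of r] by (cases "r = r0") (auto simp: abs_less_iff)
    qed
    fix u assume u: "u \<in> diameter_geodesic \<tau> \<and> (\<forall>v\<in>diameter_geodesic \<tau>. hyp_dist z u \<le> hyp_dist z v)"
    then obtain r where r: "u = of_real r * \<tau>" "-1 < r" "r < 1"
      by (auto simp: diameter_geodesic_def)
    have "hyp_dist z u \<le> hyp_dist z (of_real r0 * \<tau>)"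
      using u \<open>-1 < r0\<close> \<open>r0 < 1\<close> by (auto simp: diameter_geodesic_def)
    then show "u = of_real r0 * \<tau>"
      using less[of r] r by (cases "r = r0") (auto simp: abs_less_iff)
  qed
  then show ?thesis
    by (simp add: r0_def)
qed

lemma orthogonal_speed_eq:
  assumes \<tau>: "cmod \<tau> = 1" and z: "cmod (\<phi> t 0) < 1" and "1 \<le> cmod (cayley \<tau> (\<phi> t 0))"
  shows "orthogonal_speed \<phi> \<tau> t = ln (cmod (cayley \<tau> (\<phi> t 0))) / 2"
proof -
  define W where "W = cmod (cayley \<tau> (\<phi> t 0))"
  define r where "r = (W - 1) / (W + 1)"
  have "W \<ge> 1"
    using assms by (simp add: W_def)
  then have "0 \<le> r" "(1 + r) / (1 - r) = W"
    by (simp_all add: r_def field_simps)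
  moreover have "orthogonal_projection \<tau> (\<phi> t 0) = of_real r * \<tau>"
    unfolding orthogonal_projection_eq[OF \<tau> z] r_def W_def by simp
  ultimately show ?thesis
    using \<tau> by (simp add: orthogonal_speed_def hyp_dist_def norm_mult flip: W_def)
qed

section \<open>Trajectories in the Koenigs domain\<close>

text \<open>The semigroup seen through its Koenigs function: \<open>\<Omega>\<close> is the Koenigs domain, on which the semigroup acts by
  vertical translations, and \<open>f\<close> is a Riemann map onto the right half-plane that takes the Denjoy--Wolff
  point to \<open>\<infinity>\<close>.\<close>

locale half_plane_model =
  fixes \<Omega> :: "complex set" and f :: "complex \<Rightarrow> complex"
  assumes open_domain: "open \<Omega>" and holf: "f holomorphic_on \<Omega>" and injf: "inj_on f \<Omega>"
    and surjf: "f ` \<Omega> = right_half_plane"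
    and shift: "\<And>\<zeta> t. \<zeta> \<in> \<Omega> \<Longrightarrow> 0 \<le> t \<Longrightarrow> \<zeta> + \<i> * of_real t \<in> \<Omega>"
    and to_infinity: "\<And>\<zeta>. \<zeta> \<in> \<Omega> \<Longrightarrow> filterlim (\<lambda>t. f (\<zeta> + \<i> * of_real t)) at_infinity at_top"
begin

definition finv :: "complex \<Rightarrow> complex" where
  "finv = inv_into \<Omega> f"

lemma finv_f: "\<zeta> \<in> \<Omega> \<Longrightarrow> finv (f \<zeta>) = \<zeta>"
  using injf by (simp add: finv_def)

lemma f_finv: "Re w > 0 \<Longrightarrow> f (finv w) = w"
  and finv_in: "Re w > 0 \<Longrightarrow> finv w \<in> \<Omega>"
  using surjf by (auto simp: finv_def f_inv_into_f inv_into_into)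

lemma f_pos: "\<zeta> \<in> \<Omega> \<Longrightarrow> Re (f \<zeta>) > 0"
  using surjf by blast

lemma hol_finv: "finv holomorphic_on right_half_plane"
proof -
  obtain g where g: "g holomorphic_on f ` \<Omega>" "\<And>z. z \<in> \<Omega> \<Longrightarrow> g (f z) = z"
    using holomorphic_has_inverse[OF holf open_domain injf] by metis
  have "finv w = g w" if "w \<in> right_half_plane" for w
    using g(2)[OF finv_in, of w] f_finv[of w] that by simp
  then show ?thesis
    using g(1) unfolding surjf by (subst holomorphic_cong[OF refl]) auto
qed

lemma conjugate_holomorphic:
  assumes "T holomorphic_on \<Omega>" "T ` \<Omega> \<subseteq> U" "F holomorphic_on U"
  shows "(\<lambda>w. F (T (finv w))) holomorphic_on right_half_plane"
proof -
  have "(F \<circ> T) holomorphic_on \<Omega>"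
    using assms holomorphic_on_compose_gen by blast
  then have "(F \<circ> T \<circ> finv) holomorphic_on right_half_plane"
    by (rule holomorphic_on_compose_gen[OF hol_finv]) (use finv_in in auto)
  then show ?thesis
    by (simp add: o_def)
qed

text \<open>Every holomorphic self-map of the Koenigs domain is conjugate under \<open>f\<close> to one of the half-plane, to which
  the Schwarz--Pick inequality applies. The maps used are vertical translations and, in a starlike domain,
  dilations towards the centre.\<close>

lemma conjugate_self_map:
  assumes "T holomorphic_on \<Omega>" "T ` \<Omega> \<subseteq> \<Omega>"
  shows "(\<lambda>w. f (T (finv w))) holomorphic_on right_half_plane"
    and "(\<lambda>w. f (T (finv w))) ` right_half_plane \<subseteq> right_half_plane"
  using conjugate_holomorphic[OF assms holf] assms(2) f_pos finv_in by auto

text \<open>Translations do not increase hyperbolic distances, so two trajectories stay at bounded distance. The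
  starting point may therefore be chosen freely.\<close>

lemma trajectories_comparable:
  assumes "\<zeta> \<in> \<Omega>" "\<zeta>' \<in> \<Omega>"
  obtains K where "K > 0"
    "\<And>t. 0 \<le> t \<Longrightarrow> cmod (f (\<zeta> + \<i> * of_real t)) \<le> K * cmod (f (\<zeta>' + \<i> * of_real t))"
proof -
  obtain K where K: "K > 0" "\<And>G. G holomorphic_on right_half_plane \<Longrightarrow>
      G ` right_half_plane \<subseteq> right_half_plane \<Longrightarrow> cmod (G (f \<zeta>)) \<le> K * cmod (G (f \<zeta>'))"
    by (rule self_map_comparable[OF f_pos[OF assms(1)] f_pos[OF assms(2)]]) blast
  show ?thesis
  proof (rule that[OF K(1)])
    fix t :: real assume "0 \<le> t"
    define T where "T = (\<lambda>\<zeta>. \<zeta> + \<i> * of_real t)"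
    have T: "T holomorphic_on \<Omega>" "T ` \<Omega> \<subseteq> \<Omega>"
      using shift \<open>0 \<le> t\<close> unfolding T_def by (auto intro!: holomorphic_intros)
    show "cmod (f (\<zeta> + \<i> * of_real t)) \<le> K * cmod (f (\<zeta>' + \<i> * of_real t))"
      using K(2)[OF conjugate_self_map[OF T]] by (simp add: finv_f assms T_def)
  qed
qed

lemma Re_trajectory_mono:
  assumes "\<zeta> \<in> \<Omega>" "0 \<le> s" "s \<le> t"
  shows "Re (f (\<zeta> + \<i> * of_real s)) \<le> Re (f (\<zeta> + \<i> * of_real t))"
proof (cases "s = t")
  case False
  define T where "T = (\<lambda>\<zeta>. \<zeta> + \<i> * of_real (t - s))"
  define v where "v n = f (\<zeta> + \<i> * of_real (s + real n * (t - s)))" for n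
  have T: "T holomorphic_on \<Omega>" "T ` \<Omega> \<subseteq> \<Omega>"
    using shift[of _ "t - s"] assms unfolding T_def by (auto intro!: holomorphic_intros)
  have in\<Omega>: "\<zeta> + \<i> * of_real (s + real n * (t - s)) \<in> \<Omega>" for n
    using assms by (intro shift) auto
  have "Re (f (\<zeta> + \<i> * of_real s)) \<le> Re (f (T (finv (f (\<zeta> + \<i> * of_real s)))))"
  proof (rule Re_mono_of_iterates_to_infinity[OF conjugate_self_map[OF T], of _ v])
    show "Re (f (\<zeta> + \<i> * of_real s)) > 0" "Re (v n) > 0" for n
      using in\<Omega>[of n] in\<Omega>[of 0] by (auto simp: v_def intro: f_pos)
    show "v (Suc n) = f (T (finv (v n)))" for n
      unfolding v_def finv_f[OF in\<Omega>[of n]] by (simp add: T_def algebra_simps)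
    have "filterlim (\<lambda>n. s + real n * (t - s)) at_top sequentially"
      using False assms
      by (intro filterlim_tendsto_add_at_top[OF tendsto_const] filterlim_at_top_mult_tendsto_pos[OF tendsto_const]
          filterlim_real_sequentially) auto
    then show "filterlim v at_infinity sequentially"
      unfolding v_def by (rule filterlim_compose[OF to_infinity[OF assms(1)]])
  qed
  also have "T (finv (f (\<zeta> + \<i> * of_real s))) = \<zeta> + \<i> * of_real t"
    using in\<Omega>[of 0] by (simp add: finv_f T_def algebra_simps)
  finally show ?thesis .
qed simp

lemma trajectory_continuous:
  assumes "\<zeta> \<in> \<Omega>"
  shows "continuous_on {0..} (\<lambda>t. f (\<zeta> + \<i> * of_real t))"
proof (rule continuous_on_compose2[OF holomorphic_on_imp_continuous_on[OF holf]])
  show "continuous_on {0..} (\<lambda>t. \<zeta> + \<i> * complex_of_real t)"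
    by (intro continuous_intros)
qed (use shift[OF assms] in auto)

text \<open>\<open>G = F \<circ> finv\<close> is univalent on the half-plane, has modulus at least
  \<open>m = c t\<^sup>e\<close> on the trajectory after time \<open>t\<close>, and grows at most linearly on the real axis. The trajectory
  runs from modulus \<open>\<bar>w t\<bar>\<close> to \<open>\<infinity>\<close>, so it crosses every semicircle about 0 whose radius lies between
  \<open>\<bar>w t\<bar>\<close> and a multiple of \<open>m\<close>. In logarithmic coordinates the crossing estimate says that the quotient
  of these radii is bounded.\<close>

lemma trajectory_lower_bound:
  assumes \<zeta>: "\<zeta> \<in> \<Omega>" and holF: "F holomorphic_on \<Omega>" and injF: "inj_on F \<Omega>"
    and Fpos: "F ` \<Omega> \<subseteq> right_half_plane" and "0 < c" "0 < e"
    and growth: "\<And>s. T \<le> s \<Longrightarrow> c * s powr e \<le> cmod (F (\<zeta> + \<i> * of_real s))"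
  obtains c' where "c' > 0" "\<forall>\<^sub>F t in at_top. c' * t powr e \<le> cmod (f (\<zeta> + \<i> * of_real t))"
proof -
  define w where "w = (\<lambda>t. f (\<zeta> + \<i> * of_real t))"
  define G where "G = (\<lambda>w. F (finv w))"
  have "id holomorphic_on \<Omega>" "id ` \<Omega> \<subseteq> \<Omega>"
    by auto
  then have holG: "G holomorphic_on right_half_plane"
    using conjugate_holomorphic[OF _ _ holF, of id] by (simp add: G_def)
  have Gpos: "G ` right_half_plane \<subseteq> right_half_plane"
    using Fpos finv_in by (auto simp: G_def)
  have injG: "inj_on G right_half_plane"
  proof (rule inj_onI)
    fix a b assume "a \<in> right_half_plane" "b \<in> right_half_plane" "G a = G b"
    then have ab: "Re a > 0" "Re b > 0" "F (finv a) = F (finv b)"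
      by (auto simp: G_def)
    then have "finv a = finv b"
      using injF finv_in by (auto dest: inj_onD)
    then show "a = b"
      using f_finv ab by metis
  qed
  define M where "M = cmod (G 1)"
  have "Re (G 1) > 0"
    using subsetD[OF Gpos imageI[of 1]] by simp
  then have "M > 0"
    by (auto simp: M_def)
  have wpos: "Re (w t) > 0" if "0 \<le> t" for t
    unfolding w_def using shift[OF \<zeta> that] by (rule f_pos)
  have Gw: "G (w t) = F (\<zeta> + \<i> * of_real t)" if "0 \<le> t" for t
    unfolding w_def G_def using shift[OF \<zeta> that] by (simp add: finv_f)
  have w_inf: "eventually (\<lambda>t. B \<le> cmod (w t)) at_top" for B
  proof -
    have "\<forall>r>0. eventually (\<lambda>t. r \<le> cmod (w t)) at_top"
      using to_infinity[OF \<zeta>] unfolding w_def filterlim_at_infinity[OF order_refl] .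
    then have "eventually (\<lambda>t. max B 1 \<le> cmod (w t)) at_top"
      by (rule allE[of _ "max B 1"]) linarith
    then show ?thesis
      by eventually_elim simp
  qed
  \<comment> \<open>The crossing estimate for the strip of width \<open>\<pi>\<close> costs \<open>exp (64 \<pi>)\<close>; the factor 5 is its gap between large and small.\<close>
  define c' where "c' = c / (5 * M * exp (64 * pi))"
  have est: "c' * t powr e \<le> cmod (w t)" if t: "T \<le> t" "0 < t" and "1 \<le> cmod (w t)" for t
  proof (rule ccontr)
    assume contra: "\<not> ?thesis"
    define m where "m = c * t powr e"
    define a where "a = ln (cmod (w t))"
    define b where "b = ln (m / (5 * M))"
    have "m > 0"
      using \<open>0 < c\<close> t by (simp add: m_def)
    have "cmod (w t) * exp (64 * pi) < m / (5 * M)"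
      using contra \<open>M > 0\<close> by (simp add: c'_def m_def field_simps)
    then have "ln (cmod (w t) * exp (64 * pi)) < b"
      unfolding b_def
    proof (rule iffD2[OF ln_less_cancel_iff, rotated 2])
      show "0 < cmod (w t) * exp (64 * pi)"
        using \<open>1 \<le> cmod (w t)\<close> by (intro mult_pos_pos) auto
      show "0 < m / (5 * M)"
        using \<open>m > 0\<close> \<open>M > 0\<close> by simp
    qed
    moreover have "ln (cmod (w t) * exp (64 * pi)) = a + 64 * pi"
      using \<open>1 \<le> cmod (w t)\<close> by (subst ln_mult) (auto simp: a_def)
    ultimately have ab: "a + 64 * pi < b"
      by simp
    have "a \<ge> 0"
      using \<open>1 \<le> cmod (w t)\<close> by (simp add: a_def)
    have expb: "exp b = m / (5 * M)"
      using \<open>m > 0\<close> \<open>M > 0\<close> by (simp add: b_def)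
    obtain s1 where s1: "s1 \<ge> t" "exp b \<le> cmod (w s1)"
      using eventually_happens'[OF trivial_limit_at_top_linorder
          eventually_conj[OF w_inf[of "exp b"] eventually_ge_at_top[of t]]] by blast
    let ?S = "{z. - (pi / 2) < Im z \<and> Im z < pi / 2}"
    have exp_pos: "Re (exp z) > 0" if "z \<in> ?S" for z
      using that by (auto simp: Re_exp intro!: mult_pos_pos cos_gt_zero_pi)
    have "b - a \<le> 64 * (pi / 2 - (- (pi / 2)))"
    proof (rule crossing_estimate[where g = "\<lambda>z. G (exp z)" and \<xi> = "\<lambda>s. Ln (w s)" and m = m and ?y0.0 = 0
          and ?s0.0 = t and ?s1.0 = s1])
      have "(G \<circ> exp) holomorphic_on ?S"
        by (rule holomorphic_on_compose_gen[OF _ holG]) (use exp_pos in \<open>auto intro!: holomorphic_intros\<close>)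
      then show "(\<lambda>z. G (exp z)) holomorphic_on ?S"
        by (simp add: o_def)
      show "inj_on (\<lambda>z. G (exp z)) ?S"
      proof (rule inj_onI)
        fix z z' assume z: "z \<in> ?S" "z' \<in> ?S" "G (exp z) = G (exp z')"
        have "exp z = exp z'"
          by (rule inj_onD[OF injG z(3)]) (use exp_pos[OF z(1)] exp_pos[OF z(2)] in auto)
        show "z = z'"
          by (rule exp_complex_eqI[OF _ \<open>exp z = exp z'\<close>]) (use z in \<open>auto simp: abs_less_iff\<close>)
      qed
      show "(\<lambda>z. G (exp z)) ` ?S \<subseteq> right_half_plane"
        using Gpos exp_pos by blast
      have "continuous_on {t..s1} w"
        unfolding w_def using t by (intro continuous_on_subset[OF trajectory_continuous[OF \<zeta>]]) auto
      then show "continuous_on {t..s1} (\<lambda>s. Ln (w s))"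
      proof (intro continuous_on_Ln' ballI)
        fix s assume "s \<in> {t..s1}"
        then have "Re (w s) > 0"
          using t by (intro wpos) auto
        then show "w s \<notin> \<real>\<^sub>\<le>\<^sub>0"
          by (simp add: complex_nonpos_Reals_iff)
      qed
      show "(\<lambda>s. Ln (w s)) ` {t..s1} \<subseteq> ?S"
      proof (rule image_subsetI)
        fix s assume "s \<in> {t..s1}"
        then have "Re (w s) > 0"
          using t by (intro wpos) auto
        then show "Ln (w s) \<in> ?S"
          using Re_Ln_pos_lt_imp[of "w s"] by (auto simp: abs_less_iff)
      qed
      show "t \<le> s1" "0 < m" "- (pi / 2) < 0" "0 < pi / 2"
        using s1 \<open>m > 0\<close> by auto
      have "w t \<noteq> 0" "w s1 \<noteq> 0"
        using wpos[of t] wpos[of s1] t s1 by auto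
      then show "Re (Ln (w t)) \<le> a" "b \<le> Re (Ln (w s1))"
        using s1 by (auto simp: a_def ln_ge_iff)
      show "a \<le> b"
        using ab pi_gt_zero by linarith
      show "m \<le> cmod (G (exp (Ln (w s))))" if s: "s \<in> {t..s1}" for s
      proof -
        have "w s \<noteq> 0"
          using wpos[of s] t s by auto
        have "m \<le> c * s powr e"
          using s t \<open>0 < c\<close> \<open>0 < e\<close> by (simp add: m_def powr_mono2)
        also have "\<dots> \<le> cmod (G (w s))"
          using growth[of s] Gw[of s] s t by simp
        finally show ?thesis
          using \<open>w s \<noteq> 0\<close> by simp
      qed
      show "5 * cmod (G (exp (Complex x 0))) \<le> m" if x: "x \<in> {a..b}" for x
      proof -
        have "exp (Complex x 0) = of_real (exp x)"
          by (subst exp_eq_polar) simp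
        moreover have "cmod (G (of_real (exp x))) \<le> exp x * M"
          unfolding M_def using x \<open>a \<ge> 0\<close> by (intro self_map_growth_on_real_axis[OF holG Gpos]) auto
        moreover have "exp x \<le> m / (5 * M)"
          using x unfolding expb[symmetric] by simp
        ultimately show ?thesis
          using \<open>M > 0\<close> by (simp add: field_simps)
      qed
    qed
    with ab show False
      by simp
  qed
  show ?thesis
  proof (rule that)
    show "c' > 0"
      using \<open>0 < c\<close> \<open>M > 0\<close> by (simp add: c'_def)
    show "\<forall>\<^sub>F t in at_top. c' * t powr e \<le> cmod (f (\<zeta> + \<i> * of_real t))"
      using eventually_ge_at_top[of T] eventually_gt_at_top[of 0] w_inf[of 1]
      by eventually_elim (use est in \<open>auto simp: w_def\<close>)
  qed
qed

text \<open>The dilation with factor \<open>s / t\<close> fixes \<open>w0\<close> and moves the trajectory of \<open>w0\<close> back from time \<open>t\<close> to time \<open>s\<close>,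
  so the hyperbolic distance to \<open>f w0\<close> increases along the trajectory. The real part increases too. The two
  together exclude that \<open>cmod (w + cnj (f w0))\<close> decreases, since \<open>1 - q\<^sup>2\<close> for the distance \<open>q\<close> of \<open>w\<close> and \<open>f w0\<close>
  is a multiple of \<open>Re w / (cmod (w + cnj (f w0)))\<^sup>2\<close>.\<close>

lemma starlike_trajectory_mono:
  assumes star: "\<And>\<zeta>. \<zeta> \<in> \<Omega> \<Longrightarrow> closed_segment w0 \<zeta> \<subseteq> \<Omega>" and w0: "w0 \<in> \<Omega>" and st: "0 \<le> s" "s \<le> t"
  shows "cmod (f (w0 + \<i> * of_real s) + cnj (f w0)) \<le> cmod (f (w0 + \<i> * of_real t) + cnj (f w0))"
proof (cases "t = 0")
  case False
  then have "t > 0"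
    using st by simp
  define T where "T = (\<lambda>\<zeta>. w0 + of_real (s / t) * (\<zeta> - w0))"
  have T: "T holomorphic_on \<Omega>"
    unfolding T_def by (intro holomorphic_intros)
  have T\<Omega>: "T ` \<Omega> \<subseteq> \<Omega>"
  proof (rule image_subsetI)
    fix \<zeta> assume "\<zeta> \<in> \<Omega>"
    have "T \<zeta> = (1 - s / t) *\<^sub>R w0 + (s / t) *\<^sub>R \<zeta>"
      using \<open>t > 0\<close> by (simp add: T_def scaleR_conv_of_real field_simps)
    moreover have "0 \<le> s / t" "s / t \<le> 1"
      using st \<open>t > 0\<close> by auto
    ultimately have "T \<zeta> \<in> closed_segment w0 \<zeta>"
      unfolding in_segment by blast
    then show "T \<zeta> \<in> \<Omega>"
      using star[OF \<open>\<zeta> \<in> \<Omega>\<close>] by blast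
  qed
  let ?u = "\<lambda>t. f (w0 + \<i> * of_real t)"
  have wt: "w0 + \<i> * of_real t \<in> \<Omega>" "w0 + \<i> * of_real s \<in> \<Omega>"
    using shift[OF w0] st by auto
  have "T (w0 + \<i> * of_real t) = w0 + \<i> * of_real s" "T w0 = w0"
    using \<open>t > 0\<close> by (simp_all add: T_def)
  then have "Re (?u t) * Re (f w0) * (cmod (?u s + cnj (f w0)))\<^sup>2
      \<le> Re (?u s) * Re (f w0) * (cmod (?u t + cnj (f w0)))\<^sup>2"
    using Schwarz_Pick_conformal_factor[OF conjugate_self_map[OF T T\<Omega>] f_pos[OF wt(1)] f_pos[OF w0]]
    by (simp add: finv_f wt w0)
  also have "\<dots> \<le> Re (?u t) * Re (f w0) * (cmod (?u t + cnj (f w0)))\<^sup>2"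
    using Re_trajectory_mono[OF w0 st] f_pos[OF w0] by (intro mult_right_mono) auto
  finally have "(cmod (?u s + cnj (f w0)))\<^sup>2 \<le> (cmod (?u t + cnj (f w0)))\<^sup>2"
    using f_pos[OF wt(1)] f_pos[OF w0] by simp
  then show ?thesis
    by (rule power2_le_imp_le) simp
qed (use st in simp)

text \<open>Replacing \<open>cmod (w + cnj (f w0))\<close> by \<open>cmod w\<close> and changing the starting point each costs only a
  constant factor, as the real part stays bounded away from 0.\<close>

lemma starlike_trajectory_almost_mono:
  assumes star: "\<And>\<zeta>. \<zeta> \<in> \<Omega> \<Longrightarrow> closed_segment w0 \<zeta> \<subseteq> \<Omega>" and w0: "w0 \<in> \<Omega>" and \<zeta>: "\<zeta> \<in> \<Omega>"
  obtains K where "K > 0" "\<And>s t. 0 \<le> s \<Longrightarrow> s \<le> t \<Longrightarrow>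
    cmod (f (\<zeta> + \<i> * of_real s)) \<le> K * cmod (f (\<zeta> + \<i> * of_real t))"
proof -
  obtain K1 where K1: "K1 > 0" "\<And>t. 0 \<le> t \<Longrightarrow> cmod (f (\<zeta> + \<i> * of_real t)) \<le> K1 * cmod (f (w0 + \<i> * of_real t))"
    by (rule trajectories_comparable[OF \<zeta> w0]) blast
  obtain K2 where K2: "K2 > 0" "\<And>t. 0 \<le> t \<Longrightarrow> cmod (f (w0 + \<i> * of_real t)) \<le> K2 * cmod (f (\<zeta> + \<i> * of_real t))"
    by (rule trajectories_comparable[OF w0 \<zeta>]) blast
  define L where "L = 1 + cmod (f w0) / Re (f w0)"
  have r0: "Re (f w0) > 0"
    by (rule f_pos[OF w0])
  have "L > 0"
    using r0 by (simp add: L_def add_pos_nonneg)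
  have L: "cmod (f w0) + x \<le> L * x" if "Re (f w0) \<le> x" for x
  proof -
    have "cmod (f w0) * Re (f w0) \<le> cmod (f w0) * x"
      using that by (intro mult_left_mono) auto
    then show ?thesis
      using r0 by (simp add: L_def field_simps)
  qed
  show ?thesis
  proof (rule that)
    show "K1 * L * L * K2 > 0"
      using K1 K2 \<open>L > 0\<close> by simp
    fix s t :: real assume st: "0 \<le> s" "s \<le> t"
    let ?u = "\<lambda>t. f (w0 + \<i> * of_real t)"
    have us: "Re (?u s) > 0"
      using shift[OF w0] st by (intro f_pos) auto
    have "cmod (?u s) \<le> cmod (f w0) + cmod (?u s + cnj (f w0))"
      using norm_triangle_ineq4[of "?u s + cnj (f w0)" "cnj (f w0)"] by simp
    also have "\<dots> \<le> L * cmod (?u s + cnj (f w0))"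
      using complex_Re_le_cmod[of "?u s + cnj (f w0)"] us by (intro L) simp
    also have "\<dots> \<le> L * cmod (?u t + cnj (f w0))"
      using starlike_trajectory_mono[OF star w0 st] \<open>L > 0\<close> by simp
    also have "\<dots> \<le> L * (cmod (f w0) + cmod (?u t))"
      using norm_triangle_ineq[of "?u t" "cnj (f w0)"] \<open>L > 0\<close> by simp
    also have "\<dots> \<le> L * (L * cmod (?u t))"
      using Re_trajectory_mono[OF w0, of 0 t] st complex_Re_le_cmod[of "?u t"] \<open>L > 0\<close>
      by (intro mult_left_mono L) auto
    also have "\<dots> \<le> L * (L * (K2 * cmod (f (\<zeta> + \<i> * of_real t))))"
      using K2(2)[of t] st \<open>L > 0\<close> by simp
    finally have "K1 * cmod (?u s) \<le> K1 * (L * (L * (K2 * cmod (f (\<zeta> + \<i> * of_real t)))))"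
      using K1 by simp
    then show "cmod (f (\<zeta> + \<i> * of_real s)) \<le> K1 * L * L * K2 * cmod (f (\<zeta> + \<i> * of_real t))"
      using K1(2)[OF st(1)] by (simp add: mult.assoc)
  qed
qed

end

section \<open>Upper bound from an inscribed sector\<close>

lemma Arg_add_imaginary:
  assumes "Re z > 0" "0 \<le> s"
  shows "Arg z \<le> Arg (z + \<i> * of_real s)" "Arg (z + \<i> * of_real s) < pi / 2"
proof -
  have *: "Arg w = arctan (Im w / Re w)" if "Re w > 0" for w
    using that by (intro arg_conv_arctan)
  show "Arg z \<le> Arg (z + \<i> * of_real s)"
    using assms *[of z] *[of "z + \<i> * of_real s"] by (simp add: arctan_le_iff divide_right_mono)
  show "Arg (z + \<i> * of_real s) < pi / 2"
    using assms *[of "z + \<i> * of_real s"] arctan_ubound by simp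
qed

context half_plane_model
begin

text \<open>\<open>E\<close> maps the half-plane onto the sector of aperture \<open>\<theta>\<close> and the positive axis onto its bisector, and
  \<open>f \<circ> E\<close> grows at most linearly on the positive axis.\<close>

lemma bisector_upper_bound:
  assumes \<theta>: "0 < \<theta>" "\<theta> \<le> pi"
    and sector: "\<And>r \<phi>. 0 < r \<Longrightarrow> \<bar>\<phi> - y0\<bar> < \<theta> / 2 \<Longrightarrow> p + of_real r * cis \<phi> \<in> \<Omega>"
    and "1 \<le> r"
  shows "cmod (f (p + of_real r * cis y0)) \<le> r powr (pi / \<theta>) * cmod (f (p + cis y0))"
proof -
  define E where "E = (\<lambda>x. p + exp (\<i> * of_real y0 + of_real (\<theta> / pi) * Ln x))"
  have E_eq: "E x = p + of_real (exp (\<theta> / pi * Re (Ln x))) * cis (y0 + \<theta> / pi * Im (Ln x))" for x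
    by (simp add: E_def exp_eq_polar)
  have E\<Omega>: "E ` right_half_plane \<subseteq> \<Omega>"
  proof (rule image_subsetI)
    fix x assume "x \<in> right_half_plane"
    then have "\<bar>Im (Ln x)\<bar> < pi / 2"
      using Re_Ln_pos_lt_imp[of x] by auto
    then have "\<theta> / pi * \<bar>Im (Ln x)\<bar> < \<theta> / pi * (pi / 2)"
      using \<theta> by (intro mult_strict_left_mono) auto
    then have "\<bar>\<theta> / pi * Im (Ln x)\<bar> < \<theta> / 2"
      using \<theta> by (simp add: abs_mult)
    then show "E x \<in> \<Omega>"
      unfolding E_eq by (intro sector) auto
  qed
  have "E holomorphic_on right_half_plane"
    unfolding E_def by (intro holomorphic_intros) (auto simp: complex_nonpos_Reals_iff)
  then have "(f \<circ> E) holomorphic_on right_half_plane"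
    using holf E\<Omega> by (rule holomorphic_on_compose_gen)
  moreover have "(f \<circ> E) ` right_half_plane \<subseteq> right_half_plane"
    using E\<Omega> f_pos by auto
  moreover have "1 \<le> r powr (pi / \<theta>)"
    using \<open>1 \<le> r\<close> \<theta> by (intro ge_one_powr_ge_zero) auto
  ultimately have "cmod ((f \<circ> E) (of_real (r powr (pi / \<theta>)))) \<le> r powr (pi / \<theta>) * cmod ((f \<circ> E) 1)"
    by (rule self_map_growth_on_real_axis)
  moreover have "E (of_real (r powr (pi / \<theta>))) = p + of_real r * cis y0"
    unfolding E_eq using \<open>1 \<le> r\<close> \<theta> by (simp add: Ln_of_real ln_powr)
  moreover have "E 1 = p + cis y0"
    unfolding E_eq by simp
  ultimately show ?thesis
    by simp
qed

text \<open>The trajectory runs along the edge of the sector, far from the bisector in the hyperbolic metric, so the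
  bound on the bisector does not transfer directly. But the circular arcs of radii between \<open>t + 1\<close> and
  \<open>N (t + 1)\<close> join the two inside the domain, and after time \<open>t\<close> the modulus on the trajectory does not fall
  below \<open>m\<close>, a fixed fraction of its value at \<open>t\<close>. If \<open>m\<close> were much larger than the bound on the bisector, the
  crossing estimate in logarithmic coordinates would bound \<open>ln N\<close> by \<open>64 \<theta>\<close>.\<close>

lemma trajectory_upper_bound:
  assumes star: "starlike \<Omega>" and \<theta>: "0 < \<theta>" "\<theta> \<le> pi" and \<zeta>: "\<zeta> \<in> \<Omega>"
    and sector: "\<And>r \<phi>. 0 < r \<Longrightarrow> pi / 2 - \<theta> < \<phi> \<Longrightarrow> \<phi> < pi / 2 \<Longrightarrow> p + of_real r * cis \<phi> \<in> \<Omega>"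
  obtains C where "C > 0" "\<And>t. 1 \<le> t \<Longrightarrow> cmod (f (\<zeta> + \<i> * of_real t)) \<le> C * t powr (pi / \<theta>)"
proof -
  define y0 where "y0 = pi / 2 - \<theta> / 2"
  define \<zeta>0 where "\<zeta>0 = p + cis y0"
  define M where "M = cmod (f \<zeta>0)"
  \<comment> \<open>Any \<open>N\<close> with \<open>ln N > 64 \<pi>\<close> contradicts the crossing estimate, as the aperture is at most \<open>\<pi>\<close>.\<close>
  define N where "N = exp (64 * pi + 1)"
  have y0: "0 \<le> y0" "y0 < pi / 2" "pi / 2 - \<theta> < y0"
    using \<theta> by (auto simp: y0_def)
  have \<zeta>0: "\<zeta>0 \<in> \<Omega>"
    using sector[of 1 y0] y0 by (simp add: \<zeta>0_def)
  have "M > 0"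
    using f_pos[OF \<zeta>0] by (auto simp: M_def)
  have "N \<ge> 1"
    by (simp add: N_def)
  obtain w0 where w0: "w0 \<in> \<Omega>" "\<And>\<zeta>. \<zeta> \<in> \<Omega> \<Longrightarrow> closed_segment w0 \<zeta> \<subseteq> \<Omega>"
    using star unfolding starlike_def by blast
  obtain K where K: "K > 0" "\<And>s t. 0 \<le> s \<Longrightarrow> s \<le> t \<Longrightarrow>
      cmod (f (\<zeta>0 + \<i> * of_real s)) \<le> K * cmod (f (\<zeta>0 + \<i> * of_real t))"
    by (rule starlike_trajectory_almost_mono[OF w0(2) w0(1) \<zeta>0]) blast+
  obtain K' where K': "K' > 0"
    "\<And>t. 0 \<le> t \<Longrightarrow> cmod (f (\<zeta> + \<i> * of_real t)) \<le> K' * cmod (f (\<zeta>0 + \<i> * of_real t))"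
    by (rule trajectories_comparable[OF \<zeta> \<zeta>0]) blast
  have bisector: "cmod (f (p + of_real r * cis y0)) \<le> r powr (pi / \<theta>) * M" if "1 \<le> r" for r
    unfolding M_def \<zeta>0_def
  proof (rule bisector_upper_bound[OF \<theta> _ that])
    fix r \<phi> :: real assume "0 < r" and \<phi>: "\<bar>\<phi> - y0\<bar> < \<theta> / 2"
    have "pi / 2 - \<theta> < \<phi>" "\<phi> < pi / 2"
      using \<phi> unfolding y0_def abs_less_iff by linarith+
    with \<open>0 < r\<close> show "p + of_real r * cis \<phi> \<in> \<Omega>"
      by (rule sector)
  qed
  have cis_pos: "Re (cis y0) > 0"
    using y0 by (simp add: cos_gt_zero_pi)
  have est: "cmod (f (\<zeta>0 + \<i> * of_real t)) / K \<le> 5 * ((N * (t + 1)) powr (pi / \<theta>) * M)" if t: "1 \<le> t" for t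
  proof (rule ccontr)
    assume contra: "\<not> ?thesis"
    define m where "m = cmod (f (\<zeta>0 + \<i> * of_real t)) / K"
    define \<xi> where "\<xi> = (\<lambda>s. Ln (cis y0 + \<i> * of_real s))"
    define a where "a = ln (t + 1)"
    define b where "b = ln (N * (t + 1))"
    define s1 where "s1 = N * (t + 1) + 1"
    have ab: "b = a + 64 * pi + 1"
      unfolding a_def b_def N_def using t by (simp add: ln_mult)
    have "a \<ge> 0"
      using t by (simp add: a_def)
    have "t + 1 \<le> N * (t + 1)"
      using \<open>N \<ge> 1\<close> t by simp
    then have "t \<le> s1"
      by (simp add: s1_def)
    have pos: "Re (cis y0 + \<i> * of_real s) > 0" for s :: real
      using cis_pos by simp
    have ne: "cis y0 + \<i> * of_real s \<noteq> 0" for s :: real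
      using pos[of s] by force
    have arg: "pi / 2 - \<theta> < Arg (cis y0 + \<i> * of_real s)" "Arg (cis y0 + \<i> * of_real s) < pi / 2"
      if "0 \<le> s" for s
      using Arg_add_imaginary[OF cis_pos that] Arg_cis[of y0] y0 pi_gt_zero by auto
    let ?S = "{z. pi / 2 - \<theta> < Im z \<and> Im z < pi / 2}"
    have exp\<Omega>: "p + exp z \<in> \<Omega>" if "z \<in> ?S" for z
      using sector[of "exp (Re z)" "Im z"] that by (simp add: exp_eq_polar)
    have "b - a \<le> 64 * (pi / 2 - (pi / 2 - \<theta>))"
    proof (rule crossing_estimate[where g = "\<lambda>z. f (p + exp z)" and \<xi> = \<xi> and m = m and ?y0.0 = y0
          and ?s0.0 = t and ?s1.0 = s1])
      have "(f \<circ> (\<lambda>z. p + exp z)) holomorphic_on ?S"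
        by (rule holomorphic_on_compose_gen[OF _ holf]) (use exp\<Omega> in \<open>auto intro!: holomorphic_intros\<close>)
      then show "(\<lambda>z. f (p + exp z)) holomorphic_on ?S"
        by (simp add: o_def)
      show "inj_on (\<lambda>z. f (p + exp z)) ?S"
      proof (rule inj_onI)
        fix z z' assume z: "z \<in> ?S" "z' \<in> ?S" "f (p + exp z) = f (p + exp z')"
        have "p + exp z = p + exp z'"
          by (rule inj_onD[OF injf z(3)]) (use exp\<Omega>[OF z(1)] exp\<Omega>[OF z(2)] in auto)
        then have "exp z = exp z'"
          by simp
        show "z = z'"
          by (rule exp_complex_eqI[OF _ \<open>exp z = exp z'\<close>]) (use z \<theta> in \<open>auto simp: abs_less_iff\<close>)
      qed
      show "(\<lambda>z. f (p + exp z)) ` ?S \<subseteq> right_half_plane"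
        using exp\<Omega> f_pos by blast
      show "continuous_on {t..s1} \<xi>"
        unfolding \<xi>_def using pos
        by (intro continuous_intros) (auto simp: complex_nonpos_Reals_iff not_le)
      show "\<xi> ` {t..s1} \<subseteq> ?S"
        using arg t ne by (auto simp: \<xi>_def Arg_eq_Im_Ln[symmetric])
      show "t \<le> s1" "0 < m" "pi / 2 - \<theta> < y0" "y0 < pi / 2"
        using \<open>t \<le> s1\<close> y0 K(1) complex_Re_le_cmod[of "f (\<zeta>0 + \<i> * of_real t)"]
          f_pos[OF shift[OF \<zeta>0, of t]] t by (auto simp: m_def intro!: divide_pos_pos)
      have "cmod (cis y0 + \<i> * of_real t) \<le> t + 1"
        using norm_triangle_ineq[of "cis y0" "\<i> * of_real t"] t by (simp add: norm_mult)
      then show "Re (\<xi> t) \<le> a"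
        using ne[of t] t by (simp add: \<xi>_def a_def)
      have "0 < N * (t + 1)"
        using \<open>N \<ge> 1\<close> t by simp
      have "s1 \<ge> 0"
        using \<open>t \<le> s1\<close> t by simp
      then have "cmod (\<i> * of_real s1) = N * (t + 1) + 1"
        by (simp add: norm_mult flip: s1_def)
      then have "N * (t + 1) \<le> cmod (cis y0 + \<i> * of_real s1)"
        using norm_diff_ineq[of "\<i> * of_real s1" "cis y0"] by (simp add: add.commute)
      then show "b \<le> Re (\<xi> s1)"
        using ne[of s1] \<open>0 < N * (t + 1)\<close> by (simp add: \<xi>_def b_def)
      show "a \<le> b"
        using ab pi_gt_zero by linarith
      show "m \<le> cmod (f (p + exp (\<xi> s)))" if "s \<in> {t..s1}" for s
      proof -
        have "p + exp (\<xi> s) = \<zeta>0 + \<i> * of_real s"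
          using ne[of s] by (simp add: \<xi>_def \<zeta>0_def)
        then show ?thesis
          using K(2)[of t s] that t K(1) by (simp add: m_def field_simps)
      qed
      show "5 * cmod (f (p + exp (Complex x y0))) \<le> m" if x: "x \<in> {a..b}" for x
      proof -
        have "exp x \<le> N * (t + 1)"
          using x \<open>0 < N * (t + 1)\<close> by (simp add: b_def ln_ge_iff)
        have "cmod (f (p + exp (Complex x y0))) \<le> exp x powr (pi / \<theta>) * M"
          using bisector[of "exp x"] x \<open>a \<ge> 0\<close> by (simp add: exp_eq_polar)
        also have "\<dots> \<le> (N * (t + 1)) powr (pi / \<theta>) * M"
          using \<open>exp x \<le> N * (t + 1)\<close> \<open>M > 0\<close> \<theta> by (intro mult_right_mono powr_mono2) auto
        finally show ?thesis
          using contra by (simp add: m_def)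
      qed
    qed
    then show False
      using ab \<theta> by simp
  qed
  show ?thesis
  proof (rule that)
    show "K' * (K * (5 * ((2 * N) powr (pi / \<theta>) * M))) > 0"
      using K K' \<open>M > 0\<close> \<open>N \<ge> 1\<close> by simp
    fix t :: real assume t: "1 \<le> t"
    have "(N * (t + 1)) powr (pi / \<theta>) \<le> (2 * N * t) powr (pi / \<theta>)"
      using t \<open>N \<ge> 1\<close> \<theta> by (intro powr_mono2) auto
    also have "\<dots> = (2 * N) powr (pi / \<theta>) * t powr (pi / \<theta>)"
      by (rule powr_mult)
    finally have "5 * ((N * (t + 1)) powr (pi / \<theta>) * M) \<le> 5 * ((2 * N) powr (pi / \<theta>) * M) * t powr (pi / \<theta>)"
      using \<open>M > 0\<close> by simp
    then have "cmod (f (\<zeta>0 + \<i> * of_real t)) / K \<le> 5 * ((2 * N) powr (pi / \<theta>) * M) * t powr (pi / \<theta>)"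
      using est[OF t] by linarith
    then have "cmod (f (\<zeta>0 + \<i> * of_real t)) \<le> K * (5 * ((2 * N) powr (pi / \<theta>) * M) * t powr (pi / \<theta>))"
      using K(1) by (simp only: pos_divide_le_eq mult.commute[of K])
    then have "K' * cmod (f (\<zeta>0 + \<i> * of_real t)) \<le> K' * (K * (5 * ((2 * N) powr (pi / \<theta>) * M) * t powr (pi / \<theta>)))"
      using K'(1) by simp
    then show "cmod (f (\<zeta> + \<i> * of_real t)) \<le> K' * (K * (5 * ((2 * N) powr (pi / \<theta>) * M))) * t powr (pi / \<theta>)"
      using K'(2)[of t] t by (simp add: mult.assoc)
  qed
qed

end

section \<open>Sectors and the domain Xi\<close>

definition sector :: "real \<Rightarrow> real \<Rightarrow> complex set" where
  "sector \<alpha> \<beta> = {of_real r * cis \<phi> | r \<phi>. 0 < r \<and> \<alpha> < \<phi> \<and> \<phi> < \<beta>}"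

text \<open>The power with exponent \<open>\<pi> / (\<beta> - \<alpha>)\<close>, after a rotation of the bisector to the positive axis. An aperture
  up to \<open>2 \<pi>\<close> is admissible because the rotated sector then avoids the branch cut of the logarithm.\<close>

lemma sector_power_map:
  assumes "\<alpha> < \<beta>" "\<beta> - \<alpha> \<le> 2 * pi"
  obtains F where "F holomorphic_on sector \<alpha> \<beta>" "inj_on F (sector \<alpha> \<beta>)"
    "F ` sector \<alpha> \<beta> \<subseteq> right_half_plane"
    "\<And>z. z \<in> sector \<alpha> \<beta> \<Longrightarrow> cmod (F z) = cmod z powr (pi / (\<beta> - \<alpha>))"
proof -
  define \<gamma> where "\<gamma> = (\<alpha> + \<beta>) / 2"
  define e where "e = pi / (\<beta> - \<alpha>)"
  define F where "F = (\<lambda>z. exp (of_real e * Ln (cis (- \<gamma>) * z)))"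
  have "e > 0"
    using assms by (simp add: e_def)
  have Ln: "Im (Ln (cis (- \<gamma>) * z)) \<in> {- ((\<beta> - \<alpha>) / 2) <..< (\<beta> - \<alpha>) / 2}"
    "Re (Ln (cis (- \<gamma>) * z)) = ln (cmod z)" "cis (- \<gamma>) * z \<notin> \<real>\<^sub>\<le>\<^sub>0" if z: "z \<in> sector \<alpha> \<beta>" for z
  proof -
    obtain r \<phi> where r: "0 < r" "\<alpha> < \<phi>" "\<phi> < \<beta>" "z = of_real r * cis \<phi>"
      using z by (auto simp: sector_def)
    have bd: "- ((\<beta> - \<alpha>) / 2) < \<phi> - \<gamma>" "\<phi> - \<gamma> < (\<beta> - \<alpha>) / 2"
      using r by (auto simp: \<gamma>_def field_simps)
    have half: "(\<beta> - \<alpha>) / 2 \<le> pi"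
      using assms by simp
    have "cis (- \<gamma>) * z = exp (Complex (ln r) (\<phi> - \<gamma>))"
      using r by (simp add: exp_eq_polar cis_mult mult.left_commute)
    moreover have "Ln (exp (Complex (ln r) (\<phi> - \<gamma>))) = Complex (ln r) (\<phi> - \<gamma>)"
    proof (rule Ln_exp)
      show "- pi < Im (Complex (ln r) (\<phi> - \<gamma>))"
        using bd half unfolding complex.sel by linarith
      show "Im (Complex (ln r) (\<phi> - \<gamma>)) \<le> pi"
        using bd half unfolding complex.sel by linarith
    qed
    ultimately have *: "Ln (cis (- \<gamma>) * z) = Complex (ln r) (\<phi> - \<gamma>)"
      by simp
    then show "Im (Ln (cis (- \<gamma>) * z)) \<in> {- ((\<beta> - \<alpha>) / 2) <..< (\<beta> - \<alpha>) / 2}"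
      using bd by simp
    show "Re (Ln (cis (- \<gamma>) * z)) = ln (cmod z)"
      using * r by (simp add: norm_mult)
    have "z \<noteq> 0"
      using r by simp
    then have ne: "cis (- \<gamma>) * z \<noteq> 0"
      by simp
    have "Im (Ln (cis (- \<gamma>) * z)) \<noteq> pi"
      using bd half unfolding * complex.sel by linarith
    then show "cis (- \<gamma>) * z \<notin> \<real>\<^sub>\<le>\<^sub>0"
      using Im_Ln_eq_pi[OF ne] ne by (auto simp: complex_nonpos_Reals_iff complex_eq_iff)
  qed
  have Im_e: "\<bar>e * Im (Ln (cis (- \<gamma>) * z))\<bar> < pi / 2" if "z \<in> sector \<alpha> \<beta>" for z
  proof -
    have "\<bar>Im (Ln (cis (- \<gamma>) * z))\<bar> < (\<beta> - \<alpha>) / 2"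
      using Ln(1)[OF that] unfolding greaterThanLessThan_iff abs_less_iff by linarith
    then have "e * \<bar>Im (Ln (cis (- \<gamma>) * z))\<bar> < e * ((\<beta> - \<alpha>) / 2)"
      using \<open>e > 0\<close> by (rule mult_strict_left_mono)
    also have "\<dots> = pi / 2"
      using assms by (simp add: e_def)
    finally show ?thesis
      using \<open>e > 0\<close> by (simp add: abs_mult)
  qed
  show ?thesis
  proof (rule that)
    show "F holomorphic_on sector \<alpha> \<beta>"
      unfolding F_def using Ln(3) by (intro holomorphic_intros) auto
    show "inj_on F (sector \<alpha> \<beta>)"
    proof (rule inj_onI)
      fix z z' assume z: "z \<in> sector \<alpha> \<beta>" "z' \<in> sector \<alpha> \<beta>" "F z = F z'"
      have "of_real e * Ln (cis (- \<gamma>) * z) = of_real e * Ln (cis (- \<gamma>) * z')"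
      proof (rule exp_complex_eqI)
        show "exp (of_real e * Ln (cis (- \<gamma>) * z)) = exp (of_real e * Ln (cis (- \<gamma>) * z'))"
          using z by (simp add: F_def)
        show "\<bar>Im (of_real e * Ln (cis (- \<gamma>) * z)) - Im (of_real e * Ln (cis (- \<gamma>) * z'))\<bar> < 2 * pi"
          using Im_e[OF z(1)] Im_e[OF z(2)] by (auto simp: abs_less_iff)
      qed
      then have "Ln (cis (- \<gamma>) * z) = Ln (cis (- \<gamma>) * z')"
        using \<open>e > 0\<close> by simp
      moreover have "cis (- \<gamma>) * z \<noteq> 0" "cis (- \<gamma>) * z' \<noteq> 0"
        using Ln(3) z by force+
      ultimately have "cis (- \<gamma>) * z = cis (- \<gamma>) * z'"
        by (metis exp_Ln)
      then show "z = z'"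
        by simp
    qed
    show "F ` sector \<alpha> \<beta> \<subseteq> right_half_plane"
    proof (rule image_subsetI)
      fix z assume "z \<in> sector \<alpha> \<beta>"
      then have "- (pi / 2) < e * Im (Ln (cis (- \<gamma>) * z))" "e * Im (Ln (cis (- \<gamma>) * z)) < pi / 2"
        using Im_e[of z] unfolding abs_less_iff by linarith+
      then show "F z \<in> right_half_plane"
        by (simp add: F_def Re_exp cos_gt_zero_pi)
    qed
    show "cmod (F z) = cmod z powr (pi / (\<beta> - \<alpha>))" if z: "z \<in> sector \<alpha> \<beta>" for z
    proof -
      have "z \<noteq> 0"
        using Ln(3)[OF z] by auto
      then show ?thesis
        using Ln(2)[OF z] by (simp add: F_def powr_def flip: e_def)
    qed
  qed
qed

lemma in_sector_Arg:
  assumes "z \<noteq> 0" "\<alpha> < \<gamma> + Arg z" "\<gamma> + Arg z < \<beta>"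
  shows "cis \<gamma> * z \<in> sector \<alpha> \<beta>"
proof -
  have "z = of_real (cmod z) * cis (Arg z)"
    using rcis_cmod_Arg[of z] by (simp add: rcis_def)
  then have "cis \<gamma> * z = of_real (cmod z) * cis (\<gamma> + Arg z)"
    by (metis cis_mult mult.left_commute)
  then show ?thesis
    using assms unfolding sector_def by force
qed

lemma W_sector_eq_sector:
  assumes "0 < \<theta>" "\<theta> \<le> pi"
  shows "W_sector \<theta> = sector (pi / 2 - \<theta>) (pi / 2)"
proof (intro equalityI subsetI)
  fix z assume "z \<in> W_sector \<theta>"
  then show "z \<in> sector (pi / 2 - \<theta>) (pi / 2)"
    using in_sector_Arg[of z "pi / 2 - \<theta>" 0 "pi / 2"] by (auto simp: W_sector_def)
next
  fix z assume "z \<in> sector (pi / 2 - \<theta>) (pi / 2)"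
  then obtain r \<phi> where z: "0 < r" "pi / 2 - \<theta> < \<phi>" "\<phi> < pi / 2" "z = of_real r * cis \<phi>"
    by (auto simp: sector_def)
  then have "Arg z = \<phi>"
    using assms by (simp add: Arg_cis Arg_times_of_real)
  then show "z \<in> W_sector \<theta>"
    using z by (auto simp: W_sector_def)
qed

text \<open>The left boundary curve \<open>y = \<bar>x\<bar>\<^sup>\<alpha>\<close> is superlinear, so, moved up far enough, it stays inside any sector
  around the upward direction. The right part is a convex cone with \<open>\<i>\<close> on its boundary, so moving up keeps
  it inside itself.\<close>

lemma Xi_dom_subset_sector:
  assumes "\<alpha> > 1" "0 < \<theta>" "\<theta> \<le> pi" "0 < \<delta>"
  obtains M where "M \<ge> 0" "\<And>z. z \<in> Xi_dom \<alpha> \<theta> \<Longrightarrow> z + \<i> * of_real M \<in> sector (pi / 2 - \<theta>) (pi / 2 + \<delta>)"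
proof -
  obtain M where M: "M \<ge> 0" "\<And>x y. \<bar>x\<bar> powr \<alpha> < y \<Longrightarrow> arctan (\<bar>x\<bar> / (y + M)) < \<delta>"
  proof (cases "\<delta> < pi / 2")
    case False
    then have "arctan u < \<delta>" for u
      using arctan_ubound[of u] by linarith
    then show ?thesis
      by (intro that[of 0]) auto
  next
    case True
    define \<kappa> where "\<kappa> = tan \<delta>"
    \<comment> \<open>The value of \<open>\<bar>x\<bar>\<close> beyond which the curve \<open>y = \<bar>x\<bar>\<^sup>\<alpha>\<close> lies above the ray \<open>y = \<bar>x\<bar> / \<kappa>\<close>; up to there, the shift \<open>B / \<kappa>\<close> suffices.\<close>
    define B where "B = (1 / \<kappa>) powr (1 / (\<alpha> - 1))"
    have "\<kappa> > 0"
      using True \<open>0 < \<delta>\<close> by (simp add: \<kappa>_def tan_gt_zero)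
    then have "B > 0"
      by (simp add: B_def)
    show ?thesis
    proof (rule that[of "B / \<kappa>"])
      show "B / \<kappa> \<ge> 0"
        using \<open>B > 0\<close> \<open>\<kappa> > 0\<close> by simp
      fix x y :: real assume xy: "\<bar>x\<bar> powr \<alpha> < y"
      then have "y > 0"
        using powr_ge_zero[of "\<bar>x\<bar>" \<alpha>] by linarith
      have "\<bar>x\<bar> < \<kappa> * (y + B / \<kappa>)"
      proof (cases "\<bar>x\<bar> \<le> B")
        case True
        have "0 < \<kappa> * y"
          using \<open>\<kappa> > 0\<close> \<open>y > 0\<close> by simp
        with True show ?thesis
          using \<open>\<kappa> > 0\<close> by (simp add: distrib_left)
      next
        case False
        then have "\<bar>x\<bar> > 0"
          using \<open>B > 0\<close> by linarith
        have "1 / \<kappa> = B powr (\<alpha> - 1)"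
          using \<open>\<alpha> > 1\<close> \<open>\<kappa> > 0\<close> by (simp add: B_def powr_powr)
        also have "\<dots> \<le> \<bar>x\<bar> powr (\<alpha> - 1)"
          using False \<open>B > 0\<close> \<open>\<alpha> > 1\<close> by (intro powr_mono2) auto
        finally have "1 \<le> \<kappa> * \<bar>x\<bar> powr (\<alpha> - 1)"
          using \<open>\<kappa> > 0\<close> by (simp add: field_simps)
        then have "\<bar>x\<bar> * 1 \<le> \<bar>x\<bar> * (\<kappa> * \<bar>x\<bar> powr (\<alpha> - 1))"
          by (intro mult_left_mono) auto
        also have "\<dots> = \<kappa> * \<bar>x\<bar> powr \<alpha>"
          using \<open>\<bar>x\<bar> > 0\<close> by (simp add: powr_diff)
        also have "\<dots> < \<kappa> * y"
          using xy \<open>\<kappa> > 0\<close> by simp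
        also have "\<dots> \<le> \<kappa> * (y + B / \<kappa>)"
          using \<open>\<kappa> > 0\<close> \<open>B > 0\<close> by simp
        finally show ?thesis by simp
      qed
      moreover have "0 < y + B / \<kappa>"
        using \<open>y > 0\<close> \<open>B > 0\<close> \<open>\<kappa> > 0\<close> by (simp add: add_pos_pos)
      ultimately have "\<bar>x\<bar> / (y + B / \<kappa>) < tan \<delta>"
        by (simp add: pos_divide_less_eq flip: \<kappa>_def)
      then have "arctan (\<bar>x\<bar> / (y + B / \<kappa>)) < arctan (tan \<delta>)"
        by (rule arctan_monotone)
      also have "\<dots> = \<delta>"
        using True \<open>0 < \<delta>\<close> by (intro arctan_tan) auto
      finally show "arctan (\<bar>x\<bar> / (y + B / \<kappa>)) < \<delta>" .
    qed
  qed
  show ?thesis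
  proof (rule that[OF M(1)])
    fix z assume "z \<in> Xi_dom \<alpha> \<theta>"
    then consider "z \<in> W_sector \<theta>" | "Re z \<le> 0" "\<bar>Re z\<bar> powr \<alpha> < Im z"
      by (auto simp: Xi_dom_def Pi_dom_def)
    then show "z + \<i> * of_real M \<in> sector (pi / 2 - \<theta>) (pi / 2 + \<delta>)"
    proof cases
      case 1
      then have z: "z \<noteq> 0" "pi / 2 - \<theta> < Arg z" "Arg z < pi / 2"
        by (auto simp: W_sector_def)
      have "Re z = cmod z * cos (Arg z)"
        using rcis_cmod_Arg[of z] by (metis Re_rcis)
      then have "Re z > 0"
        using z \<open>\<theta> \<le> pi\<close> by (simp add: cos_gt_zero_pi)
      then have "z + \<i> * of_real M \<noteq> 0"
        by (auto simp: complex_eq_iff)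
      then show ?thesis
        using in_sector_Arg[of "z + \<i> * of_real M" "pi / 2 - \<theta>" 0 "pi / 2 + \<delta>"] z \<open>0 < \<delta>\<close>
          Arg_add_imaginary[OF \<open>Re z > 0\<close> M(1)] by simp
    next
      case 2
      \<comment> \<open>A quarter turn moves the left part into the right half-plane, where the argument is an arctangent.\<close>
      define u where "u = - \<i> * (z + \<i> * of_real M)"
      have "Im z > 0"
        using 2 powr_ge_zero[of "\<bar>Re z\<bar>" \<alpha>] by linarith
      then have u: "Re u > 0" "Re u = Im z + M" "Im u = \<bar>Re z\<bar>"
        using 2 M(1) by (simp_all add: u_def)
      then have "Arg u = arctan (\<bar>Re z\<bar> / (Im z + M))"
        by (subst arg_conv_arctan) auto
      moreover have "arctan (\<bar>Re z\<bar> / (Im z + M)) \<ge> 0"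
        using \<open>Im z > 0\<close> M(1) by simp
      ultimately have "0 \<le> Arg u" "Arg u < \<delta>"
        using M(2)[OF 2(2)] by auto
      moreover have "u \<noteq> 0"
        using u by auto
      ultimately have "cis (pi / 2) * u \<in> sector (pi / 2 - \<theta>) (pi / 2 + \<delta>)"
        using \<open>0 < \<theta>\<close> by (intro in_sector_Arg) auto
      also have "cis (pi / 2) * u = z + \<i> * of_real M"
        by (simp add: u_def algebra_simps)
      finally show ?thesis .
    qed
  qed
qed

section \<open>The rate of convergence\<close>

lemma koenigs_half_plane_model:
  assumes sg: "disc_semigroup \<phi>" and dw: "denjoy_wolff_point \<phi> \<tau>" and kf: "koenigs_function \<phi> h"
  defines "f \<equiv> \<lambda>\<zeta>. cayley \<tau> (inv_into unit_disc h \<zeta>)"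
  shows "half_plane_model (h ` unit_disc) f" 
    and "\<And>z t. z \<in> unit_disc \<Longrightarrow> 0 \<le> t \<Longrightarrow> f (h z + \<i> * of_real t) = cayley \<tau> (\<phi> t z)"
proof -
  have holh: "h holomorphic_on unit_disc" and injh: "inj_on h unit_disc"
    and hflow: "\<And>z t. z \<in> unit_disc \<Longrightarrow> 0 \<le> t \<Longrightarrow> h (\<phi> t z) = h z + \<i> * of_real t"
    using kf unfolding koenigs_function_def by auto
  have self: "\<phi> t z \<in> unit_disc" if "z \<in> unit_disc" "0 \<le> t" for t z
    using sg that unfolding disc_semigroup_def by blast
  have \<tau>: "cmod \<tau> = 1" and lim: "\<And>z. z \<in> unit_disc \<Longrightarrow> ((\<lambda>t. \<phi> t z) \<longlongrightarrow> \<tau>) at_top"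
    using dw unfolding denjoy_wolff_point_def by auto
  have f_h: "f (h z) = cayley \<tau> z" if "z \<in> unit_disc" for z
    using injh that by (simp add: f_def)
  show flow: "f (h z + \<i> * of_real t) = cayley \<tau> (\<phi> t z)" if "z \<in> unit_disc" "0 \<le> t" for z t
    using f_h[OF self[OF that]] hflow[OF that] by simp
  show "half_plane_model (h ` unit_disc) f"
  proof
    show "open (h ` unit_disc)"
      by (rule open_mapping_thm3[OF holh open_ball injh])
    obtain g where g: "g holomorphic_on h ` unit_disc" "\<And>z. z \<in> unit_disc \<Longrightarrow> g (h z) = z"
      using holomorphic_has_inverse[OF holh open_ball injh] by metis
    have "(\<lambda>\<zeta>. (\<tau> + g \<zeta>) / (\<tau> - g \<zeta>)) holomorphic_on h ` unit_disc"
      using cayley_denominator[OF \<tau>] g(2) by (intro holomorphic_intros g(1)) force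
    moreover have "(\<tau> + g \<zeta>) / (\<tau> - g \<zeta>) = f \<zeta>" if "\<zeta> \<in> h ` unit_disc" for \<zeta>
      using that g(2) f_h by (auto simp: cayley_def)
    ultimately show "f holomorphic_on h ` unit_disc"
      by (rule holomorphic_transform)
    show "inj_on f (h ` unit_disc)"
    proof (rule inj_onI)
      fix a b assume "a \<in> h ` unit_disc" "b \<in> h ` unit_disc" "f a = f b"
      then obtain z z' where "a = h z" "b = h z'" "z \<in> unit_disc" "z' \<in> unit_disc" "cayley \<tau> z = cayley \<tau> z'"
        using f_h by force
      then show "a = b"
        using inj_on_cayley[OF \<tau>] by (auto dest: inj_onD)
    qed
    show "f ` h ` unit_disc = right_half_plane"
    proof (intro equalityI subsetI)
      fix w assume "w \<in> f ` h ` unit_disc"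
      then show "w \<in> right_half_plane"
        using f_h Re_cayley_pos[OF \<tau>] by auto
    next
      fix w assume w: "w \<in> right_half_plane"
      define z where "z = \<tau> * ((w - 1) / (w + 1))"
      have "(cmod (w - 1))\<^sup>2 < (cmod (w + 1))\<^sup>2"
        using cmod_add_cnj_power2[of w 1] w by simp
      then have lt: "cmod (w - 1) < cmod (w + 1)"
        by (simp add: power_less_imp_less_base)
      then have "w + 1 \<noteq> 0"
        by auto
      have z: "z \<in> unit_disc"
        using lt \<tau> \<open>w + 1 \<noteq> 0\<close> by (simp add: z_def norm_mult norm_divide)
      have "\<tau> \<noteq> 0"
        using \<tau> by auto
      have "\<tau> + z = \<tau> * (2 * w / (w + 1))" "\<tau> - z = \<tau> * (2 / (w + 1))"
        using \<open>w + 1 \<noteq> 0\<close> by (simp_all add: z_def field_simps)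
      then have "cayley \<tau> z = w"
        using \<open>\<tau> \<noteq> 0\<close> \<open>w + 1 \<noteq> 0\<close> by (simp add: cayley_def)
      then show "w \<in> f ` h ` unit_disc"
        using f_h[OF z] z by (metis imageI)
    qed
    show "\<zeta> + \<i> * of_real t \<in> h ` unit_disc" if \<zeta>: "\<zeta> \<in> h ` unit_disc" and "0 \<le> t" for \<zeta> t
    proof -
      obtain z where "z \<in> unit_disc" "\<zeta> = h z"
        using \<zeta> by blast
      then show ?thesis
        using hflow[of z t] self[of z t] \<open>0 \<le> t\<close> by (metis imageI)
    qed
    show "filterlim (\<lambda>t. f (\<zeta> + \<i> * of_real t)) at_infinity at_top" if \<zeta>: "\<zeta> \<in> h ` unit_disc" for \<zeta>
    proof -
      obtain z where z: "z \<in> unit_disc" "\<zeta> = h z"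
        using \<zeta> by blast
      have ev: "eventually (\<lambda>t. cmod (\<phi> t z) < 1) at_top"
        using eventually_ge_at_top[of 0] by eventually_elim (use self[OF z(1)] in auto)
      have "filterlim (\<lambda>t. (\<tau> + \<phi> t z) * inverse (\<tau> - \<phi> t z)) at_infinity at_top"
      proof (rule tendsto_mult_filterlim_at_infinity)
        show "((\<lambda>t. \<tau> + \<phi> t z) \<longlongrightarrow> \<tau> + \<tau>) at_top"
          by (intro tendsto_intros lim z)
        have "((\<lambda>t. \<tau> - \<phi> t z) \<longlongrightarrow> \<tau> - \<tau>) at_top"
          by (intro tendsto_intros lim z)
        then have "filterlim (\<lambda>t. \<tau> - \<phi> t z) (at 0) at_top"
          unfolding filterlim_at using ev cayley_denominator[OF \<tau>] by (auto elim!: eventually_mono)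
        then show "filterlim (\<lambda>t. inverse (\<tau> - \<phi> t z)) at_infinity at_top"
          by (rule filterlim_compose[OF filterlim_inverse_at_infinity])
        show "\<tau> + \<tau> \<noteq> 0"
          using \<tau> by auto
      qed
      moreover have "eventually (\<lambda>t. (\<tau> + \<phi> t z) * inverse (\<tau> - \<phi> t z) = f (\<zeta> + \<i> * of_real t)) at_top"
        using eventually_ge_at_top[of 0]
        by eventually_elim (use flow[OF z(1)] z in \<open>simp add: cayley_def divide_inverse\<close>)
      ultimately show ?thesis
        by (rule filterlim_mono_eventually[OF _ order_refl order_refl])
    qed
  qed
qed

text \<open>The loss \<open>\<epsilon>\<close> in the exponent pays for widening the aperture from \<open>\<theta>\<close> to \<open>\<theta> / (1 - \<epsilon>)\<close>: the wider sector
  contains a translate of the whole domain \<open>Xi_dom \<alpha> \<theta>\<close>. The bound on \<open>\<epsilon>\<close> says exactly that the sector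
  gains at most \<open>\<pi>\<close>, which keeps its aperture within \<open>2 \<pi>\<close>.\<close>

lemma (in half_plane_model) lower_bound_in_Xi:
  assumes \<zeta>: "\<zeta> \<in> \<Omega>" and \<alpha>: "\<alpha> > 1" and \<theta>: "0 < \<theta>" "\<theta> \<le> pi"
    and sub: "\<Omega> \<subseteq> (+) p ` Xi_dom \<alpha> \<theta>" and \<epsilon>: "0 < \<epsilon>" "\<epsilon> \<le> pi / (\<theta> + pi)"
  obtains c where "c > 0"
    "\<forall>\<^sub>F t in at_top. c * t powr (pi / \<theta> * (1 - \<epsilon>)) \<le> cmod (f (\<zeta> + \<i> * of_real t))"
proof -
  define \<delta> where "\<delta> = \<theta> / (1 - \<epsilon>) - \<theta>"
  define e where "e = pi / \<theta> * (1 - \<epsilon>)"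
  have "\<theta> / (\<theta> + pi) \<le> 1 - \<epsilon>"
    using \<epsilon> \<theta> pi_gt_zero by (simp add: field_simps)
  moreover have "0 < \<theta> / (\<theta> + pi)"
    using \<theta> pi_gt_zero by (intro divide_pos_pos) linarith+
  ultimately have "0 < 1 - \<epsilon>"
    by linarith
  then have "\<theta> / (1 - \<epsilon>) \<le> \<theta> + pi"
    using \<open>\<theta> / (\<theta> + pi) \<le> 1 - \<epsilon>\<close> \<theta> pi_gt_zero by (simp add: field_simps)
  then have "\<delta> \<le> pi"
    by (simp add: \<delta>_def)
  have "0 < \<delta>"
    using \<theta> \<epsilon> \<open>0 < 1 - \<epsilon>\<close> by (simp add: \<delta>_def field_simps)
  let ?V = "sector (pi / 2 - \<theta>) (pi / 2 + \<delta>)"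
  have width: "pi / (pi / 2 + \<delta> - (pi / 2 - \<theta>)) = e"
    using \<theta> \<open>0 < 1 - \<epsilon>\<close> by (simp add: \<delta>_def e_def)
  have "e > 0"
    using \<theta> \<open>0 < 1 - \<epsilon>\<close> by (simp add: e_def)
  obtain M where M: "M \<ge> 0" "\<And>z. z \<in> Xi_dom \<alpha> \<theta> \<Longrightarrow> z + \<i> * of_real M \<in> ?V"
    by (rule Xi_dom_subset_sector[OF \<alpha> \<theta> \<open>0 < \<delta>\<close>]) blast
  define q where "q = p - \<i> * of_real M"
  have V: "\<zeta> - q \<in> ?V" if in\<Omega>: "\<zeta> \<in> \<Omega>" for \<zeta>
  proof -
    obtain z where "z \<in> Xi_dom \<alpha> \<theta>" "\<zeta> = p + z"
      using sub in\<Omega> by blast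
    then show ?thesis
      using M(2)[of z] by (simp add: q_def)
  qed
  obtain P where P: "P holomorphic_on ?V" "inj_on P ?V" "P ` ?V \<subseteq> right_half_plane"
    "\<And>z. z \<in> ?V \<Longrightarrow> cmod (P z) = cmod z powr e"
  proof (rule sector_power_map)
    show "pi / 2 - \<theta> < pi / 2 + \<delta>" "pi / 2 + \<delta> - (pi / 2 - \<theta>) \<le> 2 * pi"
      using \<theta> \<open>0 < \<delta>\<close> \<open>\<delta> \<le> pi\<close> by auto
  qed (use width in auto)
  define F where "F = (\<lambda>\<zeta>. P (\<zeta> - q))"
  show ?thesis
  \<comment> \<open>After time \<open>2 \<bar>\<zeta> - q\<bar>\<close> the point \<open>\<zeta> + \<i> s\<close> has distance at least \<open>s / 2\<close> from the vertex \<open>q\<close>; the added 1 makes \<open>s\<close> positive.\<close>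
  proof (rule trajectory_lower_bound[OF \<zeta>, of F "(1 / 2) powr e" e "2 * cmod (\<zeta> - q) + 1"])
    have "(P \<circ> (\<lambda>\<zeta>. \<zeta> - q)) holomorphic_on \<Omega>"
      by (rule holomorphic_on_compose_gen[OF _ P(1)]) (use V in \<open>auto intro!: holomorphic_intros\<close>)
    then show "F holomorphic_on \<Omega>"
      by (simp add: F_def o_def)
    show "inj_on F \<Omega>"
    proof (rule inj_onI)
      fix x y assume "x \<in> \<Omega>" "y \<in> \<Omega>" "F x = F y"
      then have "x - q = y - q"
        using V[of x] V[of y] inj_onD[OF P(2), of "x - q" "y - q"] by (simp add: F_def)
      then show "x = y"
        by simp
    qed
    show "F ` \<Omega> \<subseteq> right_half_plane"
      using V P(3) by (auto simp: F_def)
    show "0 < (1 / 2 :: real) powr e" "0 < e"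
      using \<open>e > 0\<close> by auto
    fix s assume s: "2 * cmod (\<zeta> - q) + 1 \<le> s"
    then have "s > 0"
      using norm_ge_zero[of "\<zeta> - q"] by linarith
    have "s / 2 \<le> cmod (\<zeta> + \<i> * of_real s - q)"
      using norm_diff_ineq[of "\<i> * of_real s" "\<zeta> - q"] s \<open>s > 0\<close>
      by (simp add: norm_mult algebra_simps)
    then have "(s / 2) powr e \<le> cmod (\<zeta> + \<i> * of_real s - q) powr e"
      using \<open>s > 0\<close> \<open>e > 0\<close> by (intro powr_mono2) auto
    also have "\<dots> = cmod (F (\<zeta> + \<i> * of_real s))"
      using V[OF shift[OF \<zeta>, of s]] \<open>s > 0\<close> P(4) by (simp add: F_def)
    also have "(s / 2) powr e = (1 / 2) powr e * s powr e"
      using \<open>s > 0\<close> powr_mult[of "1/2" s e] by simp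
    finally show "(1 / 2) powr e * s powr e \<le> cmod (F (\<zeta> + \<i> * of_real s))" .
  qed (use that in \<open>auto simp: e_def\<close>)
qed

theorem proposition7p5:
  fixes \<phi> :: "real \<Rightarrow> complex \<Rightarrow> complex" and h :: "complex \<Rightarrow> complex" and \<tau> :: complex
  assumes "disc_semigroup \<phi>" and "non_elliptic \<phi>"
    and "denjoy_wolff_point \<phi> \<tau>" and "koenigs_function \<phi> h"
  shows "(\<forall>(\<alpha>::real) (\<theta>::real) (p::complex) (\<epsilon>::real).
            \<alpha> > 1 \<and> \<theta> \<in> {0<..pi} \<and> h ` unit_disc \<subseteq> (+) p ` Xi_dom \<alpha> \<theta> \<and>
            \<epsilon> \<in> {0<..pi / (\<theta> + pi)} \<longrightarrow>
              Liminf at_top (\<lambda>t::real. ereal (orthogonal_speed \<phi> \<tau> t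
                  - pi / (2 * \<theta>) * (1 - \<epsilon>) * ln t)) > -\<infinity> \<and>
              (\<exists>K>0. \<forall>t>0. norm (\<phi> t 0 - \<tau>) \<le> K * t powr ((-1 + \<epsilon>) * pi / \<theta>))) \<and>
         (\<forall>(\<alpha>::real) (\<theta>::real) (p::complex).
            \<alpha> > 1 \<and> \<theta> \<in> {0<..pi} \<and> (+) p ` Xi_dom \<alpha> \<theta> \<subseteq> h ` unit_disc \<and>
            starlike (h ` unit_disc) \<longrightarrow>
              Limsup at_top (\<lambda>t::real. ereal (orthogonal_speed \<phi> \<tau> t
                  - pi / (2 * \<theta>) * ln t)) < \<infinity> \<and>
              (\<exists>K>0. \<forall>t\<ge>1. norm (\<phi> t 0 - \<tau>) \<ge> K * t powr (- pi / \<theta>)))"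
proof -
  define f where "f = (\<lambda>\<zeta>. cayley \<tau> (inv_into unit_disc h \<zeta>))"
  define w where "w = (\<lambda>t. cayley \<tau> (\<phi> t 0))"
  interpret half_plane_model "h ` unit_disc" f
    unfolding f_def by (rule koenigs_half_plane_model(1)[OF assms(1,3,4)])
  have fw: "f (h 0 + \<i> * of_real t) = w t" if "0 \<le> t" for t
    unfolding f_def w_def using koenigs_half_plane_model(2)[OF assms(1,3,4), of 0 t] that by simp
  have h0: "h 0 \<in> h ` unit_disc"
    by simp
  have \<tau>: "cmod \<tau> = 1"
    using assms(3) by (simp add: denjoy_wolff_point_def)
  have disc: "cmod (\<phi> t 0) < 1" if "0 \<le> t" for t
  proof -
    have "\<phi> t ` unit_disc \<subseteq> unit_disc"
      using assms(1) that by (simp add: disc_semigroup_def)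
    from subsetD[OF this imageI[of 0]] show ?thesis
      by simp
  qed
  have w_pos: "Re (w t) > 0" if "0 \<le> t" for t
    unfolding w_def by (rule Re_cayley_pos[OF \<tau> disc[OF that]])
  have dist: "cmod (\<phi> t 0 - \<tau>) = 2 / cmod (w t + 1)" if "0 \<le> t" for t
    unfolding w_def by (rule dist_eq_cayley[OF \<tau> disc[OF that]])
  have w_le: "cmod (w t) \<le> cmod (w t + 1)" if "0 \<le> t" for t
  proof (rule power2_le_imp_le)
    show "(cmod (w t))\<^sup>2 \<le> (cmod (w t + 1))\<^sup>2"
      unfolding cmod_power2 using w_pos[OF that] by (simp add: power2_eq_square algebra_simps)
  qed simp
  have w_large: "eventually (\<lambda>t. 1 \<le> cmod (w t)) at_top"
  proof -
    have "\<forall>r>0. eventually (\<lambda>t. r \<le> cmod (f (h 0 + \<i> * of_real t))) at_top"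
      using to_infinity[OF h0] unfolding filterlim_at_infinity[OF order_refl] .
    then have "eventually (\<lambda>t. 1 \<le> cmod (f (h 0 + \<i> * of_real t))) at_top"
      by (rule allE[of _ 1]) simp
    then show ?thesis
      using eventually_ge_at_top[of 0] by eventually_elim (use fw in simp)
  qed
  have speed: "eventually (\<lambda>t. orthogonal_speed \<phi> \<tau> t = ln (cmod (w t)) / 2 \<and> 1 \<le> cmod (w t)) at_top"
    using w_large eventually_ge_at_top[of 0]
  proof eventually_elim
    case (elim t)
    then show ?case
      using orthogonal_speed_eq[where \<phi> = \<phi>, OF \<tau> disc[OF elim(2)]] by (simp add: w_def)
  qed
  show ?thesis
  proof (intro conjI allI impI; elim conjE)
    fix \<alpha> \<theta> :: real and p :: complex and \<epsilon> :: real
    assume \<alpha>: "\<alpha> > 1" and \<theta>: "\<theta> \<in> {0<..pi}" and sub: "h ` unit_disc \<subseteq> (+) p ` Xi_dom \<alpha> \<theta>"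
      and \<epsilon>: "\<epsilon> \<in> {0<..pi / (\<theta> + pi)}"
    define e where "e = pi / \<theta> * (1 - \<epsilon>)"
    have "\<theta> > 0"
      using \<theta> by simp
    obtain c where "c > 0" and c: "\<forall>\<^sub>F t in at_top. c * t powr e \<le> cmod (f (h 0 + \<i> * of_real t))"
      unfolding e_def by (rule lower_bound_in_Xi[OF h0 \<alpha> _ _ sub, of \<epsilon>]) (use \<theta> \<epsilon> in auto)
    have lower: "\<forall>\<^sub>F t in at_top. c * t powr e \<le> cmod (w t)"
      using c eventually_ge_at_top[of 0] by eventually_elim (use fw in simp)
    have "eventually (\<lambda>t. ereal (ln c / 2) \<le> ereal (orthogonal_speed \<phi> \<tau> t
        - pi / (2 * \<theta>) * (1 - \<epsilon>) * ln t)) at_top"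
      using lower speed eventually_gt_at_top[of 0]
    proof eventually_elim
      case (elim t)
      have "ln c + e * ln t = ln (c * t powr e)"
        using \<open>c > 0\<close> elim(3) by (simp add: ln_mult ln_powr)
      also have "\<dots> \<le> ln (cmod (w t))"
        using elim \<open>c > 0\<close> by (intro ln_mono) auto
      finally have "(ln c + e * ln t) / 2 \<le> orthogonal_speed \<phi> \<tau> t"
        using elim(2) by simp
      moreover have "pi / (2 * \<theta>) * (1 - \<epsilon>) * ln t = e * ln t / 2"
        by (simp add: e_def)
      ultimately show ?case
        by (simp add: add_divide_distrib)
    qed
    then have "ereal (ln c / 2) \<le> Liminf at_top (\<lambda>t. ereal (orthogonal_speed \<phi> \<tau> t
        - pi / (2 * \<theta>) * (1 - \<epsilon>) * ln t))"
      by (rule Liminf_bounded)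
    then show "Liminf at_top (\<lambda>t::real. ereal (orthogonal_speed \<phi> \<tau> t
                  - pi / (2 * \<theta>) * (1 - \<epsilon>) * ln t)) > -\<infinity>"
      by (rule less_le_trans[rotated]) simp
    obtain t0 where t0: "t0 > 0" "\<And>t. t0 \<le> t \<Longrightarrow> c * t powr e \<le> cmod (w t)"
      using eventually_conj[OF lower eventually_gt_at_top[of 0]]
      unfolding eventually_at_top_linorder by (metis order_refl)
    have exponent: "(-1 + \<epsilon>) * pi / \<theta> = - e"
      by (simp add: e_def ring_distribs add_divide_distrib diff_divide_distrib)
    have "pi / (\<theta> + pi) < 1"
      using \<open>\<theta> > 0\<close> pi_gt_zero by (simp add: add_pos_pos)
    then have "0 \<le> e"
      using \<epsilon> \<open>\<theta> > 0\<close> by (auto simp: e_def)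
    show "\<exists>K>0. \<forall>t>0. norm (\<phi> t 0 - \<tau>) \<le> K * t powr ((-1 + \<epsilon>) * pi / \<theta>)"
      unfolding exponent
    proof (intro exI[of _ "2 / c + 2 * t0 powr e"] conjI allI impI)
      show "2 / c + 2 * t0 powr e > 0"
        using \<open>c > 0\<close> by (simp add: add_pos_nonneg)
      fix t :: real assume "0 < t"
      have te: "t powr (- e) > 0"
        using \<open>0 < t\<close> by simp
      show "cmod (\<phi> t 0 - \<tau>) \<le> (2 / c + 2 * t0 powr e) * t powr (- e)"
      proof (cases "t0 \<le> t")
        case True
        have "0 < c * t powr e"
          using \<open>c > 0\<close> \<open>0 < t\<close> by simp
        moreover have "c * t powr e \<le> cmod (w t + 1)"
          using t0(2)[OF True] w_le[of t] \<open>0 < t\<close> by simp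
        ultimately have "cmod (\<phi> t 0 - \<tau>) \<le> 2 / (c * t powr e)"
          using \<open>0 < t\<close> by (simp add: dist frac_le)
        also have "\<dots> = 2 / c * t powr (- e)"
          by (simp add: powr_minus field_simps)
        also have "\<dots> \<le> (2 / c + 2 * t0 powr e) * t powr (- e)"
          using te by (intro mult_right_mono) auto
        finally show ?thesis .
      next
        case False
        have "cmod (\<phi> t 0 - \<tau>) \<le> 2 * 1"
          using norm_triangle_ineq4[of "\<phi> t 0" \<tau>] disc[of t] \<tau> \<open>0 < t\<close> by simp
        also have "1 \<le> t0 powr e * t powr (- e)"
        proof -
          have "t powr e \<le> t0 powr e"
            using False \<open>0 < t\<close> \<open>0 \<le> e\<close> by (intro powr_mono2) auto
          then show ?thesis
            using \<open>0 < t\<close> by (simp add: powr_minus field_simps)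
        qed
        also have "2 * (t0 powr e * t powr (- e)) \<le> (2 / c + 2 * t0 powr e) * t powr (- e)"
          using \<open>c > 0\<close> by (simp add: distrib_right)
        finally show ?thesis by simp
      qed
    qed
  next
    fix \<alpha> \<theta> :: real and p :: complex
    assume \<theta>: "\<theta> \<in> {0<..pi}" and sub: "(+) p ` Xi_dom \<alpha> \<theta> \<subseteq> h ` unit_disc"
      and star: "starlike (h ` unit_disc)"
    define e where "e = pi / \<theta>"
    have "\<theta> > 0" "\<theta> \<le> pi"
      using \<theta> by auto
    have "0 \<le> e"
      using \<open>\<theta> > 0\<close> by (simp add: e_def)
    have sector: "p + of_real r * cis y \<in> h ` unit_disc" if "0 < r" "pi / 2 - \<theta> < y" "y < pi / 2" for r y
    proof -
      have "of_real r * cis y \<in> Xi_dom \<alpha> \<theta>"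
        unfolding Xi_dom_def W_sector_eq_sector[OF \<open>\<theta> > 0\<close> \<open>\<theta> \<le> pi\<close>] using that by (auto simp: sector_def)
      then show ?thesis
        using sub by blast
    qed
    obtain C where "C > 0" and C: "\<And>t. 1 \<le> t \<Longrightarrow> cmod (f (h 0 + \<i> * of_real t)) \<le> C * t powr e"
      unfolding e_def using trajectory_upper_bound[OF star \<open>\<theta> > 0\<close> \<open>\<theta> \<le> pi\<close> h0 sector] by blast
    have upper: "cmod (w t) \<le> C * t powr e" if "1 \<le> t" for t
      using C[OF that] fw[of t] that by simp
    have "eventually (\<lambda>t. ereal (orthogonal_speed \<phi> \<tau> t - pi / (2 * \<theta>) * ln t) \<le> ereal (ln C / 2)) at_top"
      using speed eventually_ge_at_top[of 1]
    proof eventually_elim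
      case (elim t)
      have "ln (cmod (w t)) \<le> ln (C * t powr e)"
        using elim upper[of t] by (intro ln_mono) auto
      also have "\<dots> = ln C + e * ln t"
        using \<open>C > 0\<close> elim(2) by (simp add: ln_mult ln_powr)
      finally have "orthogonal_speed \<phi> \<tau> t \<le> (ln C + e * ln t) / 2"
        using elim(1) by simp
      moreover have "pi / (2 * \<theta>) * ln t = e * ln t / 2"
        by (simp add: e_def)
      ultimately show ?case
        by (simp add: add_divide_distrib)
    qed
    then have "Limsup at_top (\<lambda>t. ereal (orthogonal_speed \<phi> \<tau> t - pi / (2 * \<theta>) * ln t)) \<le> ereal (ln C / 2)"
      by (rule Limsup_bounded)
    then show "Limsup at_top (\<lambda>t::real. ereal (orthogonal_speed \<phi> \<tau> t
                  - pi / (2 * \<theta>) * ln t)) < \<infinity>"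
      by (rule le_less_trans) simp
    show "\<exists>K>0. \<forall>t\<ge>1. norm (\<phi> t 0 - \<tau>) \<ge> K * t powr (- pi / \<theta>)"
    proof (intro exI[of _ "2 / (C + 1)"] conjI allI impI)
      show "2 / (C + 1) > 0"
        using \<open>C > 0\<close> by simp
      fix t :: real assume t: "1 \<le> t"
      have "1 \<le> t powr e"
        using t \<open>0 \<le> e\<close> by (rule ge_one_powr_ge_zero)
      have "cmod (w t + 1) \<le> cmod (w t) + 1"
        using norm_triangle_ineq[of "w t" 1] by simp
      also have "\<dots> \<le> (C + 1) * t powr e"
        using upper[OF t] \<open>1 \<le> t powr e\<close> by (simp add: distrib_right)
      finally have "2 / ((C + 1) * t powr e) \<le> 2 / cmod (w t + 1)"
        using w_le[of t] complex_Re_le_cmod[of "w t"] w_pos[of t] t \<open>C > 0\<close>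
        by (intro divide_left_mono mult_pos_pos) auto
      also have "2 / ((C + 1) * t powr e) = 2 / (C + 1) * t powr (- e)"
        by (simp add: powr_minus field_simps)
      finally show "2 / (C + 1) * t powr (- pi / \<theta>) \<le> cmod (\<phi> t 0 - \<tau>)"
        using dist[of t] t by (simp add: e_def)
    qed
  qed
qed

end
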